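(* For any $H:\mathsf X\to[1,\infty)$, the following are equivalent: (i) $\Phi$ is $H$-multiplicatively regular; (ii) the drift inequality (DV3) holds for some $V:\mathsf X\to(0,\infty)$ and some $W:\mathsf X\to[1,\infty)$ with $H\in L_\infty^W$. If either of these equivalent conditions holds, then for any $A\in\mathcal B^+$ there exist $\epsilon>0$, $1\ge\eta>0$ and $B<\infty$ satisfying $$\mathsf E_x\Big[\exp\Big(\epsilon\,\tau_A\langle L_{\tau_A},H\rangle+\eta V(\Phi(\tau_A))\Big)\Big]\le\exp(\eta V(x)+B),\qquad x\in\mathsf X,$$ where $V$ is the solution to (DV3) in (ii).
   Context: $\mathsf X$ is a Polish space with Borel $\sigma$-field $\mathcal B$; $\Phi=\{\Phi(t):t=0,1,2,\dots\}$ is a time-homogeneous Markov chain on $\mathsf X$ with transition kernel $P$; $\mathsf E_x$ denotes expectation given $\Phi(0)=x$. All functions and sets are measurable. Standing assumption: $\Phi$ is $\psi$-irreducible and aperiodic, i.e. there is a $\sigma$-finite measure $\psi$ such that for every $A\in\mathcal B$ with $\psi(A)>0$ and every $x$, $P^t(x,A)>0$ for all $t$ sufficiently large; $\psi$ is taken maximal (any other such measure is absolutely continuous with respect to $\psi$). $\mathcal B^+=\{A\in\mathcal B:\psi(A)>0\}$. $\tau_A=\inf\{t\ge1:\Phi(t)\in A\}$; $L_n=\frac1n\sum_{t=0}^{n-1}\delta_{\Phi(t)}$, so that $\tau_A\langle L_{\tau_A},H\rangle=\sum_{t=0}^{\tau_A-1}H(\Phi(t))$. $H$-multiplicative regularity: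 a set $C\in\mathcal B$ is $H$-multiplicatively regular if for any $A\in\mathcal B^+$ there exists $\eta=\eta(A)>0$ with $\sup_{x\in C}\mathsf E_x[\exp(\eta\tau_A\langle L_{\tau_A},H\rangle)]<\infty$. The process $\Phi$ is $H$-multiplicatively regular if there exist an $H$-multiplicatively regular set $C\in\mathcal B$ and $\eta>0$ such that $\mathsf E_x[\exp(\eta\tau_C\langle L_{\tau_C},H\rangle)]<\infty$ for all $x\in\mathsf X$. A set $C\in\mathcal B$ is small if there are $\epsilon>0$, a probability measure $\nu$ and a measure $m$ on $\{0,1,2,\dots\}$ with finite mean such that $\sum_{t\ge0}P^t(x,A)m(t)\ge\epsilon\mathbb 1_C(x)\nu(A)$ for all $x$, $A\in\mathcal B$. The nonlinear generator is $\mathcal H(G)=\log(e^{-G}Pe^G)$. $L_\infty^W=\{g:\sup_x|g(x)|/W(x)<\infty\}$. (DV3) with Lyapunov function $V$: for a function $W:\mathsf X\to[1,\infty)$, a small set $C$ and constants $\delta>0$, $b<\infty$, $\mathcal H(V)\le-\delta W+b\mathbb 1_C$ on $\{V<\infty\}$. *)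

theory Defs
  imports "HOL-Probability.Probability"
begin

text \<open>
  Transition kernels on a Polish space \<open>'a\<close> are measurable maps
  \<open>P \<in> borel \<rightarrow>\<^sub>M prob_algebra borel\<close>.
\<close>

section \<open>The chain\<close>

primrec kernel_pow :: "('a::polish_space \<Rightarrow> 'a measure) \<Rightarrow> nat \<Rightarrow> 'a \<Rightarrow> 'a measure" where
  "kernel_pow P 0 x = return borel x"
| "kernel_pow P (Suc t) x = kernel_pow P t x \<bind> P"

text \<open>
  Conditional law of the state at time \<open>n\<close> given the states at times \<open>0, \<dots>, n - 1\<close>, for the chain
  started in \<open>x\<close>. The law of the whole path, under which the expectations \<open>E\<^sub>x\<close> are taken, is the
  measure on sequences obtained from these by the Ionescu-Tulcea theorem.
\<close>

definition chain_step ::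
  "('a::polish_space \<Rightarrow> 'a measure) \<Rightarrow> 'a \<Rightarrow> nat \<Rightarrow> (nat \<Rightarrow> 'a) \<Rightarrow> 'a measure" where
  "chain_step P x n \<omega> = (if n = 0 then return borel x else P (\<omega> (n - 1)))"

definition path_law ::
  "('a::polish_space \<Rightarrow> 'a measure) \<Rightarrow> 'a \<Rightarrow> (nat \<Rightarrow> 'a) measure" where
  "path_law P x =
     projective_family.lim UNIV (Ionescu_Tulcea.CI (chain_step P x) (\<lambda>_. borel)) (\<lambda>_. borel)"

lemma Ionescu_Tulcea_chain_step:
  assumes P: "P \<in> borel \<rightarrow>\<^sub>M prob_algebra (borel :: 'a::polish_space measure)"
  shows "Ionescu_Tulcea (chain_step P x) (\<lambda>_. borel)"
proof (rule Ionescu_Tulcea.intro)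
  have P': "P \<in> borel \<rightarrow>\<^sub>M subprob_algebra borel"
    using P by (rule measurable_prob_algebraD)
  show "chain_step P x i \<in> Pi\<^sub>M {0..<i} (\<lambda>_. borel) \<rightarrow>\<^sub>M subprob_algebra borel" for i
  proof (cases i)
    case 0
    then show ?thesis
      by (simp add: chain_step_def[abs_def] space_subprob_algebra subprob_space_return)
  next
    case (Suc n)
    then have "(\<lambda>\<omega>. P (\<omega> n)) \<in> Pi\<^sub>M {0..<i} (\<lambda>_. borel) \<rightarrow>\<^sub>M subprob_algebra borel"
      by (intro measurable_compose[OF _ P'] measurable_component_singleton) auto
    then show ?thesis
      using Suc by (simp add: chain_step_def[abs_def])
  qed
  have "prob_space (P y)" for y
    using measurable_space[OF P, of y] by (simp add: space_prob_algebra)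
  then show "prob_space (chain_step P x i \<omega>)" if "\<omega> \<in> space (Pi\<^sub>M {0..<i} (\<lambda>_. borel))" for i \<omega>
    by (simp add: chain_step_def prob_space_return)
qed

lemma sets_path_law:
  assumes "P \<in> borel \<rightarrow>\<^sub>M prob_algebra (borel :: 'a::polish_space measure)"
  shows "sets (path_law P x) = sets (Pi\<^sub>M UNIV (\<lambda>_. borel))"
proof -
  interpret Ionescu_Tulcea "chain_step P x" "\<lambda>_. borel"
    using assms by (rule Ionescu_Tulcea_chain_step)
  show ?thesis
    by (simp add: path_law_def)
qed

text \<open>Finite-dimensional distributions: the first \<open>n\<close> coordinates are generated step by step.\<close>

lemma distr_path_law:
  assumes "P \<in> borel \<rightarrow>\<^sub>M prob_algebra (borel :: 'a::polish_space measure)"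
  shows "distr (path_law P x) (Pi\<^sub>M {0..<n} (\<lambda>_. borel)) (\<lambda>\<omega>. restrict \<omega> {0..<n}) =
    Ionescu_Tulcea.C (chain_step P x) (\<lambda>_. borel) 0 n (\<lambda>_. undefined)"
proof -
  interpret Ionescu_Tulcea "chain_step P x" "\<lambda>_. borel"
    using assms by (rule Ionescu_Tulcea_chain_step)
  have *: "up_to {0..<n} \<le> n"
    by (simp add: up_to_iff)
  have **: "n \<le> up_to {0..<n}"
    using up_to[of "{0..<n}"] by (cases n) auto
  have "distr (path_law P x) (Pi\<^sub>M {0..<n} (\<lambda>_. borel)) (\<lambda>\<omega>. restrict \<omega> {0..<n}) = CI {0..<n}"
    unfolding path_law_def by (rule distr_lim) simp
  also have "\<dots> = C 0 n (\<lambda>_. undefined)"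
  proof -
    have "up_to {0..<n} = n"
      using * ** by simp
    then have "CI {0..<n} = distr (C 0 n (\<lambda>_. undefined)) (C 0 n (\<lambda>_. undefined)) (\<lambda>f. f)"
      unfolding CI_def
      by (intro distr_cong) (auto simp: sets_C space_C space_PiM PiE_def extensional_restrict)
    then show ?thesis
      by (simp add: distr_id[unfolded id_def])
  qed
  finally show ?thesis .
qed

section \<open>Irreducibility and aperiodicity\<close>

definition irreducibility_measure ::
  "('a::polish_space \<Rightarrow> 'a measure) \<Rightarrow> 'a measure \<Rightarrow> bool" where
  "irreducibility_measure P \<phi> \<longleftrightarrow>
     sets \<phi> = sets borel \<and> sigma_finite_measure \<phi> \<and>
     (\<forall>A\<in>sets borel. emeasure \<phi> A > 0 \<longrightarrow>
        (\<forall>x. \<forall>\<^sub>F t in sequentially. emeasure (kernel_pow P t x) A > 0))"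

text \<open>
  As usual the maximal irreducibility measure is nonzero; the zero measure has the defining
  property for every kernel.
\<close>

definition irreducible_aperiodic ::
  "('a::polish_space \<Rightarrow> 'a measure) \<Rightarrow> 'a measure \<Rightarrow> bool" where
  "irreducible_aperiodic P \<psi> \<longleftrightarrow>
     irreducibility_measure P \<psi> \<and> emeasure \<psi> UNIV > 0 \<and>
     (\<forall>\<phi>. irreducibility_measure P \<phi> \<longrightarrow> absolutely_continuous \<psi> \<phi>)"

definition positive_sets :: "'a::polish_space measure \<Rightarrow> 'a set set" where
  "positive_sets \<psi> = {A \<in> sets borel. emeasure \<psi> A > 0}"

section \<open>Extended exponential and logarithm\<close>

definition exp_ext :: "ereal \<Rightarrow> ennreal" where
  "exp_ext a = (case a of ereal r \<Rightarrow> ennreal (exp r) | PInfty \<Rightarrow> \<infinity> | MInfty \<Rightarrow> 0)"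

definition ln_ext :: "ennreal \<Rightarrow> ereal" where
  "ln_ext c = (if c = 0 then -\<infinity> else if c = \<infinity> then \<infinity> else ereal (ln (enn2real c)))"

section \<open>Multiplicative regularity\<close>

definition return_time :: "'a set \<Rightarrow> (nat \<Rightarrow> 'a) \<Rightarrow> enat" where
  "return_time A \<omega> = Inf {enat t | t. t \<ge> 1 \<and> \<omega> t \<in> A}"

text \<open>
  The sum \<open>n \<langle>L\<^sub>n, H\<rangle>\<close> of \<open>H (\<omega> t)\<close> over \<open>t < n\<close>, used with \<open>n = return_time A \<omega>\<close>. For \<open>H \<ge> 1\<close>
  it is \<open>\<infinity>\<close> on paths that never return, so its extended exponential is \<open>\<infinity>\<close> on them too, and adding a
  real value such as \<open>V\<close> at the (then meaningless) time \<open>the_enat \<infinity>\<close> does not change this.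
\<close>

definition path_sum :: "('a \<Rightarrow> real) \<Rightarrow> enat \<Rightarrow> (nat \<Rightarrow> 'a) \<Rightarrow> ereal" where
  "path_sum H n \<omega> = (\<Sum>t. if enat t < n then ereal (H (\<omega> t)) else 0)"

definition exp_moment ::
  "('a::polish_space \<Rightarrow> 'a measure) \<Rightarrow> ('a \<Rightarrow> real) \<Rightarrow> 'a set \<Rightarrow> real \<Rightarrow> 'a \<Rightarrow> ennreal" where
  "exp_moment P H A \<eta> x =
     (\<integral>\<^sup>+\<omega>. exp_ext (ereal \<eta> * path_sum H (return_time A \<omega>) \<omega>) \<partial>path_law P x)"

definition mult_regular_set ::
  "('a::polish_space \<Rightarrow> 'a measure) \<Rightarrow> 'a measure \<Rightarrow> ('a \<Rightarrow> real) \<Rightarrow> 'a set \<Rightarrow> bool" where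
  "mult_regular_set P \<psi> H C \<longleftrightarrow>
     C \<in> sets borel \<and>
     (\<forall>A\<in>positive_sets \<psi>. \<exists>\<eta>>0. (SUP x\<in>C. exp_moment P H A \<eta> x) < \<infinity>)"

definition mult_regular ::
  "('a::polish_space \<Rightarrow> 'a measure) \<Rightarrow> 'a measure \<Rightarrow> ('a \<Rightarrow> real) \<Rightarrow> bool" where
  "mult_regular P \<psi> H \<longleftrightarrow>
     (\<exists>C. mult_regular_set P \<psi> H C \<and> (\<exists>\<eta>>0. \<forall>x. exp_moment P H C \<eta> x < \<infinity>))"

section \<open>The drift condition\<close>

definition small_set :: "('a::polish_space \<Rightarrow> 'a measure) \<Rightarrow> 'a set \<Rightarrow> bool" where
  "small_set P C \<longleftrightarrow>
     C \<in> sets borel \<and>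
     (\<exists>\<epsilon>>0. \<exists>\<nu> (m :: nat measure).
        sets \<nu> = sets borel \<and> prob_space \<nu> \<and>
        sets m = UNIV \<and> (\<integral>\<^sup>+t. of_nat t \<partial>m) < \<infinity> \<and>
        (\<forall>x. \<forall>A\<in>sets borel.
           (\<Sum>t. emeasure (kernel_pow P t x) A * emeasure m {t})
             \<ge> ennreal \<epsilon> * indicator C x * emeasure \<nu> A))"

definition nonlinear_generator ::
  "('a::polish_space \<Rightarrow> 'a measure) \<Rightarrow> ('a \<Rightarrow> real) \<Rightarrow> 'a \<Rightarrow> ereal" where
  "nonlinear_generator P G x =
     ln_ext (ennreal (exp (- G x)) * (\<integral>\<^sup>+y. ennreal (exp (G y)) \<partial>P x))"

definition L_infty :: "('a::polish_space \<Rightarrow> real) \<Rightarrow> ('a \<Rightarrow> real) set" where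
  "L_infty W = {g \<in> borel_measurable borel. (SUP x. ereal (\<bar>g x\<bar> / W x)) < \<infinity>}"

text \<open>
  Lyapunov functions are finite everywhere here, so the restriction to \<open>{V < \<infinity>}\<close> in the drift
  inequality is vacuous.
\<close>

definition DV3 ::
  "('a::polish_space \<Rightarrow> 'a measure) \<Rightarrow> ('a \<Rightarrow> real) \<Rightarrow> ('a \<Rightarrow> real) \<Rightarrow> bool" where
  "DV3 P V W \<longleftrightarrow>
     V \<in> borel_measurable borel \<and> (\<forall>x. V x > 0) \<and>
     W \<in> borel_measurable borel \<and> (\<forall>x. W x \<ge> 1) \<and>
     (\<exists>C \<delta> b. small_set P C \<and> \<delta> > 0 \<and>
        (\<forall>x. nonlinear_generator P V x \<le> ereal (- \<delta> * W x + b * indicator C x)))"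

end

theory Submission
  imports Defs
begin

text \<open>
  Expectations up to the return time \<open>\<tau>\<close> to a set \<open>A\<close> are handled through one-step operators rather
  than through the path space. For a weight \<open>a\<close> let \<open>T f = a \<cdot> P (1\<^bsub>-A\<^esub> f)\<close>. If \<open>\<tau>\<close> is almost surely
  finite, then \<open>E\<^sub>x[a(\<Phi>\<^sub>0) \<dots> a(\<Phi>\<^bsub>\<tau>-1\<^esub>) f(\<Phi>\<^sub>\<tau>)]\<close> is the series \<open>\<Sum>n. T\<^sup>n g\<close> with \<open>g = a \<cdot> P (1\<^sub>A f)\<close>
  (\<open>nn_integral_return_time\<close>), hence the least solution of \<open>S = g + T S\<close>. So a bound only needs a
  supersolution \<open>g + T S \<le> S\<close> (\<open>suminf_weighted_step_le\<close>), and no stopping theorem is used.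

  \<^bold>\<open>Drift implies the exponential bound.\<close> The drift condition says that \<open>e\<^sup>V\<close> is a supersolution for the
  weight \<open>exp (d H - b 1\<^sub>C)\<close>; the obstacle is the term \<open>b 1\<^sub>C\<close>. Since \<open>C\<close> is small, the chain
  started in \<open>C\<close> hits \<open>A\<close> within \<open>N\<close> steps with probability at least some \<open>c > 0\<close>
  (\<open>small_set_survival\<close>). The function \<open>z(x) = 1 + E\<^sub>x[min \<tau> N]\<close> is then a bounded supersolution for a
  weight \<open>exp (\<beta> 1\<^sub>C)\<close> with \<open>\<beta> > 0\<close> (\<open>exists_bounded_supersolution\<close>). By the weighted inequality of
  arithmetic and geometric means, \<open>S = e\<^sup>\<eta>\<^sup>V z\<^bsup>1-\<eta>\<^esup>\<close> is a supersolution for the product of the powers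
  \<open>\<eta>\<close> and \<open>1 - \<eta>\<close> of the two weights, and \<open>\<eta> b = (1 - \<eta>) \<beta>\<close> makes the contributions of \<open>C\<close> cancel.
  What remains is the weight \<open>exp (\<eta> d H)\<close>, and \<open>z\<close> is bounded: this is the asserted estimate
  (\<open>DV3_exponential_bound\<close>). It makes every sublevel set of \<open>V\<close> regular, and some sublevel set has
  positive measure, so the chain is regular (\<open>DV3_imp_mult_regular\<close>).

  \<^bold>\<open>Regularity implies drift.\<close> Let \<open>G\<close> be the exponential moment up to the return to the regular set
  \<open>C\<close>. The first-step equation \<open>G = exp (\<eta> H) \<cdot> P (1\<^sub>C + 1\<^bsub>-C\<^esub> G)\<close> says that \<open>V = 1 + log G\<close> off \<open>C\<close>
  and \<open>V = 1\<close> on \<open>C\<close> satisfies (DV3) with \<open>W = H\<close>, provided that \<open>G\<close> is bounded on \<open>C\<close> and that \<open>C\<close>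
  is small (\<open>exp_moment_imp_DV3\<close>). Regularity bounds \<open>G\<close> on \<open>C\<close> once \<open>C\<close> is positive, and this
  follows from the maximality of \<open>\<psi>\<close>, because every point leads to \<open>C\<close> (\<open>recurrent_set_positive\<close>).
  For smallness it suffices to find one positive set \<open>D\<close> on which a resolvent of the chain is minorized:
  by regularity, \<open>C\<close> reaches \<open>D\<close> uniformly. Such a set exists (\<open>exists_minorized_positive_set\<close>)
  because every resolvent measure dominates a fixed probability measure \<open>\<mu>\<close>. A single Radon-Nikodym
  derivative on the product space gives a jointly measurable density \<open>h\<close> of \<open>\<mu>\<close> with respect to
  the resolvent kernel \<open>K\<close>. Where \<open>h \<le> n\<close>, \<open>K\<close> has density at least \<open>1/n\<close> with respect to \<open>\<mu>\<close>; as
  \<open>h\<close> is finite almost everywhere, two such steps can be chained through at least half of the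
  intermediate points, which minorizes \<open>K\<^sup>2\<close>.
\<close>

section \<open>Iterated kernels\<close>

locale markov_kernel =
  fixes P :: "'a::polish_space \<Rightarrow> 'a measure"
  assumes kernel: "P \<in> borel \<rightarrow>\<^sub>M prob_algebra borel"
begin

lemma kernel_subprob [measurable]: "P \<in> borel \<rightarrow>\<^sub>M subprob_algebra borel"
  using kernel by (rule measurable_prob_algebraD)

lemma sets_kernel [simp, measurable_cong]: "sets (P x) = sets borel"
  and prob_space_kernel: "prob_space (P x)"
  using measurable_space[OF kernel, of x] by (simp_all add: space_prob_algebra)

lemma space_kernel [simp]: "space (P x) = UNIV"
  using sets_eq_imp_space_eq[OF sets_kernel, of x] by simp

lemma emeasure_kernel_UNIV [simp]: "emeasure (P x) UNIV = 1"
  using prob_space.emeasure_space_1[OF prob_space_kernel, of x] by simp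

lemma kernel_pow_prob: "kernel_pow P t \<in> borel \<rightarrow>\<^sub>M prob_algebra borel"
proof (induction t)
  case 0
  have "kernel_pow P 0 = return borel" by auto
  then show ?case using measurable_return_prob_space by simp
next
  case (Suc t)
  have "kernel_pow P (Suc t) = (\<lambda>x. kernel_pow P t x \<bind> P)" by auto
  then show ?case
    using measurable_bind_prob_space[OF Suc kernel] by simp
qed

lemma kernel_pow_subprob [measurable]: "kernel_pow P t \<in> borel \<rightarrow>\<^sub>M subprob_algebra borel"
  using kernel_pow_prob by (rule measurable_prob_algebraD)

lemma sets_kernel_pow [simp, measurable_cong]: "sets (kernel_pow P t x) = sets borel"
  and prob_space_kernel_pow: "prob_space (kernel_pow P t x)"
  using measurable_space[OF kernel_pow_prob, of x t] by (simp_all add: space_prob_algebra)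

lemma space_kernel_pow [simp]: "space (kernel_pow P t x) = UNIV"
  using sets_eq_imp_space_eq[OF sets_kernel_pow, of t x] by simp

lemma emeasure_kernel_pow_UNIV [simp]: "emeasure (kernel_pow P t x) UNIV = 1"
  using prob_space.emeasure_space_1[OF prob_space_kernel_pow, of t x] by simp

lemma emeasure_kernel_pow_le_1: "emeasure (kernel_pow P t x) A \<le> 1"
  using emeasure_space[of "kernel_pow P t x" A] by simp

lemma kernel_pow_add:
  "kernel_pow P (s + t) x = kernel_pow P s x \<bind> kernel_pow P t"
proof (induction t)
  case 0
  have "kernel_pow P 0 = return borel" by auto
  then show ?case by (simp add: bind_return'')
next
  case (Suc t)
  have "kernel_pow P (s + Suc t) x = (kernel_pow P s x \<bind> kernel_pow P t) \<bind> P"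
    using Suc by simp
  also have "\<dots> = kernel_pow P s x \<bind> (\<lambda>y. kernel_pow P t y \<bind> P)"
    by (rule bind_assoc[where N = borel and R = borel])
      (simp_all add: measurable_cong_sets[OF sets_kernel_pow refl])
  finally show ?case by simp
qed

lemma emeasure_kernel_pow_add:
  assumes [measurable]: "A \<in> sets borel"
  shows "emeasure (kernel_pow P (s + t) x) A =
    (\<integral>\<^sup>+y. emeasure (kernel_pow P t y) A \<partial>kernel_pow P s x)"
  unfolding kernel_pow_add
  by (rule emeasure_bind[where N = borel]) auto

lemma kernel_pow_1: "kernel_pow P (Suc 0) x = P x"
  by (simp add: bind_return[where N = borel])

end

section \<open>Weighted steps and the path law\<close>

definition weighted_step ::
  "('a \<Rightarrow> 'a measure) \<Rightarrow> ('a \<Rightarrow> ennreal) \<Rightarrow> 'a set \<Rightarrow> ('a \<Rightarrow> ennreal) \<Rightarrow> 'a \<Rightarrow> ennreal" where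
  "weighted_step P a A f x = a x * (\<integral>\<^sup>+y. f y * indicator A y \<partial>P x)"

text \<open>
  The weight collected before time \<open>n\<close>, set to zero as soon as a state at one of the times \<open>1, \<dots>, n\<close>
  lies in \<open>A\<close>; the state at time \<open>0\<close> may lie in \<open>A\<close>, as return times only look at positive times.
\<close>

definition taboo_weight :: "('a \<Rightarrow> ennreal) \<Rightarrow> 'a set \<Rightarrow> nat \<Rightarrow> (nat \<Rightarrow> 'a) \<Rightarrow> ennreal" where
  "taboo_weight a A n \<omega> = (\<Prod>t<n. a (\<omega> t) * indicator (- A) (\<omega> (Suc t)))"

context markov_kernel
begin

lemma weighted_step_measurable [measurable]:
  assumes [measurable]: "a \<in> borel_measurable borel" "A \<in> sets borel" "f \<in> borel_measurable borel"
  shows "weighted_step P a A f \<in> borel_measurable borel"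
  unfolding weighted_step_def[abs_def] by measurable

lemma weighted_step_iterate_measurable [measurable]:
  assumes [measurable]: "a \<in> borel_measurable borel" "A \<in> sets borel" "f \<in> borel_measurable borel"
  shows "(weighted_step P a A ^^ n) f \<in> borel_measurable borel"
  by (induction n) auto

lemma nn_integral_path_law_restrict:
  assumes F [measurable]: "F \<in> borel_measurable (Pi\<^sub>M {0..<n} (\<lambda>_. borel))"
  shows "(\<integral>\<^sup>+\<omega>. F (restrict \<omega> {0..<n}) \<partial>path_law P x) =
    (\<integral>\<^sup>+\<omega>. F \<omega> \<partial>Ionescu_Tulcea.C (chain_step P x) (\<lambda>_. borel) 0 n (\<lambda>_. undefined))"
proof -
  have "(\<lambda>\<omega>. restrict \<omega> {0..<n}) \<in> path_law P x \<rightarrow>\<^sub>M Pi\<^sub>M {0..<n} (\<lambda>_. borel)"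
    unfolding measurable_cong_sets[OF sets_path_law[OF kernel] refl]
    by (rule measurable_restrict_subset) simp
  then show ?thesis
    unfolding distr_path_law[OF kernel, symmetric]
    by (subst nn_integral_distr) auto
qed

lemma nn_integral_path_law_0:
  assumes f [measurable]: "f \<in> borel_measurable borel"
  shows "(\<integral>\<^sup>+\<omega>. f (\<omega> 0) \<partial>path_law P x) = f x"
proof -
  interpret Ionescu_Tulcea "chain_step P x" "\<lambda>_. borel"
    using kernel by (rule Ionescu_Tulcea_chain_step)
  have und: "(\<lambda>_. undefined) \<in> space (Pi\<^sub>M {0..<0} (\<lambda>_. borel))"
    by (simp add: space_PiM PiE_def extensional_def)
  have "(\<integral>\<^sup>+\<omega>. f (\<omega> 0) \<partial>path_law P x) = (\<integral>\<^sup>+\<omega>. f (restrict \<omega> {0..<Suc 0} 0) \<partial>path_law P x)"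
    by simp
  also have "\<dots> = (\<integral>\<^sup>+\<omega>. f (\<omega> 0) \<partial>C 0 (Suc 0) (\<lambda>_. undefined))"
    by (rule nn_integral_path_law_restrict) measurable
  also have "\<dots> = (\<integral>\<^sup>+\<omega>. f (\<omega> 0) \<partial>eP 0 (\<lambda>_. undefined))"
    unfolding C.simps using bind_return[OF measurable_eP[of 0] und] by (simp only: add_0_right)
  also have "\<dots> = (\<integral>\<^sup>+y. f y \<partial>chain_step P x 0 (\<lambda>_. undefined))"
    using und by (subst nn_integral_eP) auto
  also have "\<dots> = f x"
    by (simp add: chain_step_def nn_integral_return)
  finally show ?thesis .
qed

text \<open>
  The Markov property in the only form that is needed: integrating out the last coordinate. It comes
  from the finite-dimensional distributions, since the first \<open>n + 2\<close> coordinates are obtained from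
  the first \<open>n + 1\<close> by one step of the kernel.
\<close>

lemma nn_integral_path_law_next:
  assumes g [measurable]: "g \<in> borel_measurable (Pi\<^sub>M {0..<Suc n} (\<lambda>_. borel))"
    and f [measurable]: "f \<in> borel_measurable borel"
  shows "(\<integral>\<^sup>+\<omega>. g (restrict \<omega> {0..<Suc n}) * f (\<omega> (Suc n)) \<partial>path_law P x) =
    (\<integral>\<^sup>+\<omega>. g (restrict \<omega> {0..<Suc n}) * (\<integral>\<^sup>+y. f y \<partial>P (\<omega> n)) \<partial>path_law P x)"
proof -
  interpret Ionescu_Tulcea "chain_step P x" "\<lambda>_. borel"
    using kernel by (rule Ionescu_Tulcea_chain_step)
  let ?u = "\<lambda>_. undefined :: 'a"
  let ?F = "\<lambda>\<omega>. g (restrict \<omega> {0..<Suc n}) * f (\<omega> (Suc n))"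
  have und: "?u \<in> space (Pi\<^sub>M {0..<0} (\<lambda>_. borel))"
    by (simp add: space_PiM PiE_def extensional_def)
  have Fm [measurable]: "?F \<in> borel_measurable (Pi\<^sub>M {0..<Suc (Suc n)} (\<lambda>_. borel))"
    by (intro borel_measurable_times_ennreal measurable_compose[OF _ g]
        measurable_restrict_subset measurable_compose[OF _ f] measurable_component_singleton) auto
  have "(\<integral>\<^sup>+\<omega>. ?F \<omega> \<partial>path_law P x) = (\<integral>\<^sup>+\<omega>. ?F (restrict \<omega> {0..<Suc (Suc n)}) \<partial>path_law P x)"
    by (simp add: Int_absorb2 Int_absorb1 restrict_restrict del: atLeastLessThanSuc)
  also have "\<dots> = (\<integral>\<^sup>+\<omega>. ?F \<omega> \<partial>C 0 (Suc (Suc n)) ?u)"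
    by (rule nn_integral_path_law_restrict) (rule Fm)
  also have "\<dots> = (\<integral>\<^sup>+\<omega>. \<integral>\<^sup>+\<omega>'. ?F \<omega>' \<partial>eP (Suc n) \<omega> \<partial>C 0 (Suc n) ?u)"
    unfolding C.simps(2)[of 0 "Suc n"]
    by (subst nn_integral_bind[where B = "Pi\<^sub>M {0..<Suc (Suc n)} (\<lambda>_. borel)"])
      (use measurable_eP[of "Suc n"] und in
        \<open>auto simp: measurable_cong_sets[OF sets_C[OF und] refl] simp del: C.simps\<close>)
  also have "\<dots> = (\<integral>\<^sup>+\<omega>. g \<omega> * (\<integral>\<^sup>+y. f y \<partial>P (\<omega> n)) \<partial>C 0 (Suc n) ?u)"
  proof (rule nn_integral_cong)
    fix \<omega> assume "\<omega> \<in> space (C 0 (Suc n) ?u)"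
    then have \<omega>: "\<omega> \<in> space (Pi\<^sub>M {0..<Suc n} (\<lambda>_. borel))"
      using space_C[OF und, of "Suc n"] by simp
    have r: "restrict (fun_upd \<omega> (Suc n) y) {0..<Suc n} = \<omega>" for y
      using \<omega> by (auto simp: space_PiM PiE_def extensional_def)
    have "(\<integral>\<^sup>+\<omega>'. ?F \<omega>' \<partial>eP (Suc n) \<omega>) = (\<integral>\<^sup>+y. ?F (fun_upd \<omega> (Suc n) y) \<partial>chain_step P x (Suc n) \<omega>)"
      by (rule nn_integral_eP[OF \<omega> Fm])
    also have "\<dots> = (\<integral>\<^sup>+y. g \<omega> * f y \<partial>P (\<omega> n))"
      by (simp add: r chain_step_def)
    also have "\<dots> = g \<omega> * (\<integral>\<^sup>+y. f y \<partial>P (\<omega> n))"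
      by (rule nn_integral_cmult) simp
    finally show "(\<integral>\<^sup>+\<omega>'. ?F \<omega>' \<partial>eP (Suc n) \<omega>) = g \<omega> * (\<integral>\<^sup>+y. f y \<partial>P (\<omega> n))" .
  qed
  also have "\<dots> = (\<integral>\<^sup>+\<omega>. g (restrict \<omega> {0..<Suc n}) *
      (\<integral>\<^sup>+y. f y \<partial>P (restrict \<omega> {0..<Suc n} n)) \<partial>path_law P x)"
    by (rule nn_integral_path_law_restrict[symmetric]) measurable
  finally show ?thesis by simp
qed

text \<open>
  Removing the last coordinate turns the test function \<open>f\<close> into \<open>weighted_step P a (- A) f\<close>, so
  the iterates build up from the end of the path.
\<close>

lemma nn_integral_path_law_weighted:
  assumes [measurable]: "a \<in> borel_measurable borel" "A \<in> sets borel" "f \<in> borel_measurable borel"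
  shows "(\<integral>\<^sup>+\<omega>. taboo_weight a A n \<omega> * f (\<omega> n) \<partial>path_law P x) = (weighted_step P a (- A) ^^ n) f x"
    (is "?W n f = _")
  using assms(3)
proof (induction n arbitrary: f)
  case 0
  then show ?case by (simp add: taboo_weight_def nn_integral_path_law_0)
next
  case (Suc n)
  note [measurable] = Suc.prems
  let ?g = "\<lambda>\<omega>. taboo_weight a A n \<omega> * a (\<omega> n)"
  have g: "?g \<in> borel_measurable (Pi\<^sub>M {0..<Suc n} (\<lambda>_. borel))"
    unfolding taboo_weight_def by measurable
  have r: "?g (restrict \<omega> {0..<Suc n}) = ?g \<omega>" for \<omega>
    by (simp add: taboo_weight_def)
  have "?W (Suc n) f = (\<integral>\<^sup>+\<omega>. ?g (restrict \<omega> {0..<Suc n}) * (f (\<omega> (Suc n)) * indicator (- A) (\<omega> (Suc n))) \<partial>path_law P x)"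
    unfolding r by (simp add: taboo_weight_def mult_ac)
  also have "\<dots> = (\<integral>\<^sup>+\<omega>. ?g (restrict \<omega> {0..<Suc n}) * (\<integral>\<^sup>+y. f y * indicator (- A) y \<partial>P (\<omega> n)) \<partial>path_law P x)"
    by (rule nn_integral_path_law_next[OF g]) measurable
  also have "\<dots> = ?W n (weighted_step P a (- A) f)"
    unfolding r by (simp add: weighted_step_def mult_ac)
  also have "\<dots> = (weighted_step P a (- A) ^^ Suc n) f x"
    by (subst Suc.IH) (auto simp: funpow_Suc_right simp del: funpow.simps)
  finally show ?case .
qed

lemma nn_integral_path_law_hit:
  assumes [measurable]: "a \<in> borel_measurable borel" "A \<in> sets borel" "f \<in> borel_measurable borel"
  shows "(\<integral>\<^sup>+\<omega>. taboo_weight a A n \<omega> * a (\<omega> n) * (indicator A (\<omega> (Suc n)) * f (\<omega> (Suc n))) \<partial>path_law P x)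
    = (weighted_step P a (- A) ^^ n) (weighted_step P a A f) x"
proof -
  let ?g = "\<lambda>\<omega>. taboo_weight a A n \<omega> * a (\<omega> n)"
  have g: "?g \<in> borel_measurable (Pi\<^sub>M {0..<Suc n} (\<lambda>_. borel))"
    unfolding taboo_weight_def by measurable
  have r: "?g (restrict \<omega> {0..<Suc n}) = ?g \<omega>" for \<omega>
    by (simp add: taboo_weight_def)
  have "(\<integral>\<^sup>+\<omega>. ?g \<omega> * (indicator A (\<omega> (Suc n)) * f (\<omega> (Suc n))) \<partial>path_law P x)
     = (\<integral>\<^sup>+\<omega>. ?g (restrict \<omega> {0..<Suc n}) * (f (\<omega> (Suc n)) * indicator A (\<omega> (Suc n))) \<partial>path_law P x)"
    unfolding r by (simp add: mult_ac)
  also have "\<dots> = (\<integral>\<^sup>+\<omega>. ?g (restrict \<omega> {0..<Suc n}) * (\<integral>\<^sup>+y. f y * indicator A y \<partial>P (\<omega> n)) \<partial>path_law P x)"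
    by (rule nn_integral_path_law_next[OF g]) measurable
  also have "\<dots> = (\<integral>\<^sup>+\<omega>. taboo_weight a A n \<omega> * weighted_step P a A f (\<omega> n) \<partial>path_law P x)"
    unfolding r by (simp add: weighted_step_def mult_ac)
  also have "\<dots> = (weighted_step P a (- A) ^^ n) (weighted_step P a A f) x"
    by (rule nn_integral_path_law_weighted) measurable
  finally show ?thesis .
qed

end

section \<open>Return times\<close>

lemma return_time_eq_Suc_iff:
  "return_time A \<omega> = enat (Suc n) \<longleftrightarrow> \<omega> (Suc n) \<in> A \<and> (\<forall>t<n. \<omega> (Suc t) \<notin> A)"
proof
  let ?S = "{enat t | t. t \<ge> 1 \<and> \<omega> t \<in> A}"
  assume L: "return_time A \<omega> = enat (Suc n)"
  then have ne: "?S \<noteq> {}"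
    unfolding return_time_def Inf_enat_def by (metis enat.distinct(1))
  then have "Inf ?S \<in> ?S"
    by (auto simp: Inf_enat_def intro: LeastI)
  then have "\<omega> (Suc n) \<in> A"
    using L by (auto simp: return_time_def)
  moreover have "\<omega> (Suc t) \<notin> A" if "t < n" for t
  proof
    assume "\<omega> (Suc t) \<in> A"
    then have "Inf ?S \<le> enat (Suc t)"
      by (intro Inf_lower) auto
    then show False
      using L that by (auto simp: return_time_def)
  qed
  ultimately show "\<omega> (Suc n) \<in> A \<and> (\<forall>t<n. \<omega> (Suc t) \<notin> A)" by simp
next
  let ?S = "{enat t | t. t \<ge> 1 \<and> \<omega> t \<in> A}"
  assume R: "\<omega> (Suc n) \<in> A \<and> (\<forall>t<n. \<omega> (Suc t) \<notin> A)"
  have "enat (Suc n) \<le> Inf ?S"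
  proof (rule Inf_greatest)
    fix e assume "e \<in> ?S"
    then obtain t where "e = enat t" "t \<ge> 1" "\<omega> t \<in> A" by auto
    then show "enat (Suc n) \<le> e"
      using R by (cases t) (auto simp: not_less[symmetric])
  qed
  moreover have "Inf ?S \<le> enat (Suc n)"
    using R by (intro Inf_lower) auto
  ultimately show "return_time A \<omega> = enat (Suc n)"
    by (simp add: return_time_def)
qed

lemma return_time_eq_infinity_iff: "return_time A \<omega> = \<infinity> \<longleftrightarrow> (\<forall>t. \<omega> (Suc t) \<notin> A)"
proof
  assume L: "return_time A \<omega> = \<infinity>"
  show "\<forall>t. \<omega> (Suc t) \<notin> A"
  proof (rule allI notI)+
    fix t assume "\<omega> (Suc t) \<in> A"
    then have "return_time A \<omega> \<le> enat (Suc t)"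
      unfolding return_time_def by (intro Inf_lower) auto
    then show False using L by simp
  qed
next
  assume "\<forall>t. \<omega> (Suc t) \<notin> A"
  then have "{enat t | t. t \<ge> 1 \<and> \<omega> t \<in> A} = {}"
    by (auto simp: gr0_conv_Suc Suc_le_eq)
  then show "return_time A \<omega> = \<infinity>"
    unfolding return_time_def by (simp only: Inf_enat_def if_True simp_thms)
qed

lemma return_time_cases:
  obtains (finite) n where "return_time A \<omega> = enat (Suc n)" "\<omega> (Suc n) \<in> A" "\<And>t. t < n \<Longrightarrow> \<omega> (Suc t) \<notin> A"
    | (infinite) "return_time A \<omega> = \<infinity>" "\<And>t. \<omega> (Suc t) \<notin> A"
proof (cases "\<forall>t. \<omega> (Suc t) \<notin> A")
  case True
  then show ?thesis using infinite by (auto simp: return_time_eq_infinity_iff)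
next
  case False
  define n where "n = (LEAST t. \<omega> (Suc t) \<in> A)"
  have "\<omega> (Suc n) \<in> A"
    using False unfolding n_def by (auto intro: LeastI)
  moreover have "\<omega> (Suc t) \<notin> A" if "t < n" for t
    using that not_less_Least unfolding n_def by blast
  ultimately show ?thesis
    using finite[of n] by (auto simp: return_time_eq_Suc_iff)
qed

lemma path_sum_enat: "path_sum H (enat n) \<omega> = ereal (\<Sum>t<n. H (\<omega> t))"
proof -
  have "path_sum H (enat n) \<omega> = (\<Sum>t<n. if enat t < enat n then ereal (H (\<omega> t)) else 0)"
    unfolding path_sum_def by (rule suminf_finite) auto
  also have "\<dots> = (\<Sum>t<n. ereal (H (\<omega> t)))"
    by (rule sum.cong) auto
  finally show ?thesis by simp
qed

text \<open>
  As \<open>H \<ge> 1\<close>, additive functionals dominate time; exponential moments of \<open>H\<close> therefore control tails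
  of return times.
\<close>

lemma path_sum_ge:
  assumes "\<And>x. H x \<ge> 1" and "enat N \<le> n"
  shows "ereal (real N) \<le> path_sum H n \<omega>"
proof -
  have "ereal (real N) = (\<Sum>t<N. ereal 1)"
    by simp
  also have "\<dots> \<le> (\<Sum>t<N. if enat t < n then ereal (H (\<omega> t)) else 0)"
  proof (rule sum_mono)
    fix t assume "t \<in> {..<N}"
    then have "enat t < n"
      using assms(2) by (auto intro: less_le_trans[of _ "enat N"])
    then show "ereal 1 \<le> (if enat t < n then ereal (H (\<omega> t)) else 0)"
      using assms(1) by simp
  qed
  also have "\<dots> \<le> path_sum H n \<omega>"
    unfolding path_sum_def
    by (rule suminf_upper) (auto intro: order_trans[OF zero_le_one assms(1)])
  finally show ?thesis .
qed

lemma exp_ext_mono: "a \<le> b \<Longrightarrow> exp_ext a \<le> exp_ext b"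
  by (cases a; cases b) (auto simp: exp_ext_def intro: ennreal_leI)

lemma taboo_weight_one:
  "taboo_weight (\<lambda>_. 1) A n \<omega> = indicator {\<omega>. \<forall>t<n. \<omega> (Suc t) \<notin> A} \<omega>"
  by (induction n) (auto simp: taboo_weight_def less_Suc_eq split: split_indicator)

text \<open>
  The weight in the \<open>k\<close>-th term contains the indicator of a first return at time \<open>k + 1\<close>, so only one
  term survives.
\<close>

lemma suminf_taboo_weight_hit:
  fixes f :: "'a \<Rightarrow> ennreal"
  assumes "\<omega> (Suc n) \<in> A" "\<And>t. t < n \<Longrightarrow> \<omega> (Suc t) \<notin> A"
  shows "(\<Sum>k. taboo_weight a A k \<omega> * a (\<omega> k) * (indicator A (\<omega> (Suc k)) * f (\<omega> (Suc k)))) =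
    (\<Prod>t<Suc n. a (\<omega> t)) * f (\<omega> (Suc n))"
proof -
  have 0: "taboo_weight a A k \<omega> * a (\<omega> k) * (indicator A (\<omega> (Suc k)) * f (\<omega> (Suc k))) = 0"
    if "k \<notin> {n}" for k
  proof (cases "k < n")
    case True
    then show ?thesis using assms by simp
  next
    case False
    then have "n < k" using that by simp
    then have "taboo_weight a A k \<omega> = 0"
      unfolding taboo_weight_def using assms(1) \<open>n < k\<close>
      by (intro prod_zero) (auto intro!: bexI[of _ n])
    then show ?thesis by simp
  qed
  have "taboo_weight a A n \<omega> = (\<Prod>t<n. a (\<omega> t))"
    unfolding taboo_weight_def using assms(2) by (intro prod.cong) auto
  then show ?thesis
    using assms(1) by (subst suminf_finite[of "{n}", OF _ 0]) auto
qed

section \<open>Survival probabilities and functionals of the return time\<close>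

context markov_kernel
begin

text \<open>
  The probability of not returning to \<open>A\<close> up to time \<open>n\<close>, as an iterate of the kernel killed on \<open>A\<close>; the
  path-space description is the lemma below.
\<close>

definition survival :: "'a set \<Rightarrow> nat \<Rightarrow> 'a \<Rightarrow> ennreal" where
  "survival A n = (weighted_step P (\<lambda>_. 1) (- A) ^^ n) (\<lambda>_. 1)"

lemma survival_path_law:
  assumes [measurable]: "A \<in> sets borel"
  shows "survival A n x = (\<integral>\<^sup>+\<omega>. indicator {\<omega>. \<forall>t<n. \<omega> (Suc t) \<notin> A} \<omega> \<partial>path_law P x)"
  unfolding survival_def
  by (subst nn_integral_path_law_weighted[symmetric]) (auto simp: taboo_weight_one)

text \<open>
  The bridge between paths and operators: the hypothesis on survival makes the paths that never return a
  null set, and the others are split according to the value of the return time.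
\<close>

lemma nn_integral_return_time:
  assumes [measurable]: "a \<in> borel_measurable borel" "A \<in> sets borel" "f \<in> borel_measurable borel"
    and F: "\<And>\<omega> n. return_time A \<omega> = enat (Suc n) \<Longrightarrow> F \<omega> = (\<Prod>t<Suc n. a (\<omega> t)) * f (\<omega> (Suc n))"
    and surv: "(\<lambda>n. survival A n x) \<longlonglongrightarrow> 0"
  shows "(\<integral>\<^sup>+\<omega>. F \<omega> \<partial>path_law P x) =
    (\<Sum>n. (weighted_step P a (- A) ^^ n) (weighted_step P a A f) x)"
proof -
  let ?N = "{\<omega>. \<forall>t. \<omega> (Suc t) \<notin> A}"
  have [measurable_cong]: "sets (path_law P x) = sets (Pi\<^sub>M UNIV (\<lambda>_. borel))"
    by (rule sets_path_law[OF kernel])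
  have sp: "space (path_law P x) = UNIV"
    using sets_eq_imp_space_eq[OF sets_path_law[OF kernel], of x] by (simp add: space_PiM)
  have "{\<omega> \<in> space (path_law P x). \<forall>t. \<omega> (Suc t) \<notin> A} \<in> sets (path_law P x)"
    by measurable
  then have N: "?N \<in> sets (path_law P x)"
    by (simp add: sp)
  have "emeasure (path_law P x) ?N \<le> survival A n x" for n
  proof -
    have "emeasure (path_law P x) ?N = (\<integral>\<^sup>+\<omega>. indicator ?N \<omega> \<partial>path_law P x)"
      using N by simp
    also have "\<dots> \<le> survival A n x"
      unfolding survival_path_law[OF assms(2)] by (rule nn_integral_mono) (auto split: split_indicator)
    finally show ?thesis .
  qed
  then have "emeasure (path_law P x) ?N \<le> 0"
    by (intro LIMSEQ_le_const[OF surv]) auto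
  then have null: "?N \<in> null_sets (path_law P x)"
    using N by auto
  have "AE \<omega> in path_law P x. F \<omega> =
      (\<Sum>k. taboo_weight a A k \<omega> * a (\<omega> k) * (indicator A (\<omega> (Suc k)) * f (\<omega> (Suc k))))"
    using AE_not_in[OF null]
  proof eventually_elim
    fix \<omega> assume "\<omega> \<notin> ?N"
    then show "F \<omega> = (\<Sum>k. taboo_weight a A k \<omega> * a (\<omega> k) * (indicator A (\<omega> (Suc k)) * f (\<omega> (Suc k))))"
      by (cases \<omega> A rule: return_time_cases) (auto simp: F suminf_taboo_weight_hit)
  qed
  then have "(\<integral>\<^sup>+\<omega>. F \<omega> \<partial>path_law P x) = (\<integral>\<^sup>+\<omega>. (\<Sum>k. taboo_weight a A k \<omega> * a (\<omega> k) *
      (indicator A (\<omega> (Suc k)) * f (\<omega> (Suc k)))) \<partial>path_law P x)"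
    by (rule nn_integral_cong_AE)
  also have "\<dots> = (\<Sum>k. \<integral>\<^sup>+\<omega>. taboo_weight a A k \<omega> * a (\<omega> k) *
      (indicator A (\<omega> (Suc k)) * f (\<omega> (Suc k))) \<partial>path_law P x)"
    unfolding taboo_weight_def by (rule nn_integral_suminf) measurable
  also have "\<dots> = (\<Sum>n. (weighted_step P a (- A) ^^ n) (weighted_step P a A f) x)"
    by (simp add: nn_integral_path_law_hit)
  finally show ?thesis .
qed

lemma weighted_step_mono:
  "(\<And>x. a x \<le> b x) \<Longrightarrow> (\<And>x. f x \<le> g x) \<Longrightarrow> weighted_step P a A f x \<le> weighted_step P b A g x"
  unfolding weighted_step_def by (intro mult_mono nn_integral_mono) (auto intro: mult_right_mono)

lemma weighted_step_add:
  assumes [measurable]: "A \<in> sets borel" "f \<in> borel_measurable borel" "g \<in> borel_measurable borel"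
  shows "weighted_step P a A (\<lambda>y. f y + g y) x = weighted_step P a A f x + weighted_step P a A g x"
  unfolding weighted_step_def by (simp add: distrib_right nn_integral_add distrib_left)

lemma weighted_step_suminf:
  assumes [measurable]: "A \<in> sets borel" "\<And>n. f n \<in> borel_measurable borel"
  shows "weighted_step P a A (\<lambda>y. \<Sum>n. f n y) x = (\<Sum>n. weighted_step P a A (f n) x)"
proof -
  have "(\<integral>\<^sup>+y. (\<Sum>n. f n y) * indicator A y \<partial>P x) = (\<integral>\<^sup>+y. (\<Sum>n. f n y * indicator A y) \<partial>P x)"
    by simp
  also have "\<dots> = (\<Sum>n. \<integral>\<^sup>+y. f n y * indicator A y \<partial>P x)"
    by (rule nn_integral_suminf) measurable
  finally show ?thesis
    unfolding weighted_step_def by simp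
qed

text \<open>
  Comparison principle: the partial sums are the iterates of \<open>f \<mapsto> g + T f\<close> started in \<open>0\<close>, and a
  monotone iteration that starts below a supersolution stays below it.
\<close>

lemma suminf_weighted_step_le:
  assumes [measurable]: "a \<in> borel_measurable borel" "A \<in> sets borel" "g \<in> borel_measurable borel"
    and S: "\<And>x. g x + weighted_step P a A S x \<le> S x"
  shows "(\<Sum>n. (weighted_step P a A ^^ n) g x) \<le> S x"
proof (rule suminf_le_const)
  show "(\<Sum>n<m. (weighted_step P a A ^^ n) g x) \<le> S x" for m
  proof (induction m arbitrary: x)
    case (Suc m)
    have eq: "weighted_step P a A (\<lambda>y. \<Sum>n<m. (weighted_step P a A ^^ n) g y) x =
      (\<Sum>n<m. (weighted_step P a A ^^ Suc n) g x)" for m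
    proof (induction m)
      case 0
      then show ?case by (simp add: weighted_step_def)
    next
      case (Suc m)
      then show ?case by (simp add: weighted_step_add)
    qed
    have "(\<Sum>n<Suc m. (weighted_step P a A ^^ n) g x) =
        g x + weighted_step P a A (\<lambda>y. \<Sum>n<m. (weighted_step P a A ^^ n) g y) x"
      unfolding eq by (subst sum.lessThan_Suc_shift) simp
    also have "\<dots> \<le> g x + weighted_step P a A S x"
      by (intro add_left_mono weighted_step_mono Suc) auto
    finally show ?case using S[of x] by simp
  qed simp
qed auto

lemma survival_Suc:
  "survival A (Suc n) x = (\<integral>\<^sup>+y. survival A n y * indicator (- A) y \<partial>P x)"
  by (simp add: survival_def weighted_step_def)

lemma survival_0 [simp]: "survival A 0 x = 1"
  by (simp add: survival_def)

lemma survival_measurable [measurable]: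
  "A \<in> sets borel \<Longrightarrow> survival A n \<in> borel_measurable borel"
  unfolding survival_def by (rule weighted_step_iterate_measurable) auto

text \<open>
  Markov's inequality: on the event of not having returned up to time \<open>n\<close> the exponent is at least
  \<open>\<eta> n\<close>.
\<close>

lemma survival_bound_exp_moment:
  assumes "A \<in> sets borel" "\<And>x. H x \<ge> 1" "\<eta> > 0"
  shows "ennreal (exp (\<eta> * real n)) * survival A n x \<le> exp_moment P H A \<eta> x"
proof -
  have [measurable_cong]: "sets (path_law P x) = sets (Pi\<^sub>M UNIV (\<lambda>_. borel))"
    by (rule sets_path_law[OF kernel])
  note [measurable] = assms(1)
  have "ennreal (exp (\<eta> * real n)) * survival A n x =
    (\<integral>\<^sup>+\<omega>. ennreal (exp (\<eta> * real n)) * indicator {\<omega>. \<forall>t<n. \<omega> (Suc t) \<notin> A} \<omega> \<partial>path_law P x)"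
    unfolding survival_path_law[OF assms(1)] taboo_weight_one[symmetric] taboo_weight_def
    by (subst nn_integral_cmult) auto
  also have "\<dots> \<le> exp_moment P H A \<eta> x"
    unfolding exp_moment_def
  proof (rule nn_integral_mono)
    fix \<omega>
    have "ennreal (exp (\<eta> * real n)) \<le> exp_ext (ereal \<eta> * path_sum H (return_time A \<omega>) \<omega>)"
      if "\<forall>t<n. \<omega> (Suc t) \<notin> A"
    proof -
      have "enat n \<le> return_time A \<omega>"
        using that by (cases \<omega> A rule: return_time_cases) (auto intro: ccontr)
      then have "ereal (real n) \<le> path_sum H (return_time A \<omega>) \<omega>"
        using assms(2) by (rule path_sum_ge[rotated])
      then have "ereal \<eta> * ereal (real n) \<le> ereal \<eta> * path_sum H (return_time A \<omega>) \<omega>"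
        using assms(3) by (intro ereal_mult_left_mono) auto
      then show ?thesis
        using exp_ext_mono by (fastforce simp: exp_ext_def)
    qed
    then show "ennreal (exp (\<eta> * real n)) * indicator {\<omega>. \<forall>t<n. \<omega> (Suc t) \<notin> A} \<omega>
        \<le> exp_ext (ereal \<eta> * path_sum H (return_time A \<omega>) \<omega>)"
      by (auto split: split_indicator)
  qed
  finally show ?thesis .
qed

lemma survival_antimono:
  "m \<le> n \<Longrightarrow> survival A n x \<le> survival A m x"
proof (induction n rule: dec_induct)
  case (step n)
  have "survival A (Suc n) x \<le> survival A n x" for x n
  proof (induction n arbitrary: x)
    case 0
    have "survival A (Suc 0) x \<le> (\<integral>\<^sup>+y. 1 \<partial>P x)"
      unfolding survival_Suc by (intro nn_integral_mono) (auto split: split_indicator)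
    then show ?case by simp
  next
    case (Suc n)
    then show ?case
      unfolding survival_Suc[of A "Suc n"] survival_Suc[of A n]
      by (intro nn_integral_mono mult_right_mono) auto
  qed
  then show ?case using step.IH order_trans by blast
qed simp

text \<open>
  Being in \<open>A\<close> at time \<open>n + 1\<close> excludes survival up to that time.
\<close>

lemma survival_add_hit_le:
  assumes [measurable]: "A \<in> sets borel"
  shows "survival A (Suc n) x + emeasure (kernel_pow P (Suc n) x) A \<le> 1"
proof (induction n arbitrary: x)
  case 0
  have "survival A (Suc 0) x + emeasure (P x) A =
      (\<integral>\<^sup>+y. indicator (- A) y + indicator A y \<partial>P x)"
    by (subst nn_integral_add) (auto simp: survival_Suc)
  also have "\<dots> = (\<integral>\<^sup>+y. 1 \<partial>P x)"
    by (rule nn_integral_cong) (auto split: split_indicator)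
  finally show ?case by (simp add: kernel_pow_1 del: kernel_pow.simps)
next
  case (Suc n)
  have "kernel_pow P (Suc (Suc n)) x = kernel_pow P (Suc 0 + Suc n) x" by simp
  then have "emeasure (kernel_pow P (Suc (Suc n)) x) A = (\<integral>\<^sup>+y. emeasure (kernel_pow P (Suc n) y) A \<partial>P x)"
    by (metis emeasure_kernel_pow_add[OF assms] kernel_pow_1)
  then have "survival A (Suc (Suc n)) x + emeasure (kernel_pow P (Suc (Suc n)) x) A
     = (\<integral>\<^sup>+y. survival A (Suc n) y * indicator (- A) y + emeasure (kernel_pow P (Suc n) y) A \<partial>P x)"
    unfolding survival_Suc[of A "Suc n"]
    by (subst nn_integral_add) (auto simp del: kernel_pow.simps)
  also have "\<dots> \<le> (\<integral>\<^sup>+y. 1 \<partial>P x)"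
    by (rule nn_integral_mono)
       (auto intro: order_trans[OF _ Suc] emeasure_kernel_pow_le_1 simp del: kernel_pow.simps split: split_indicator)
  finally show ?case by simp
qed

text \<open>
  The union bound over the possible times of a visit, in the form of an induction on the first step.
\<close>

lemma one_le_survival_add_hits:
  assumes [measurable]: "A \<in> sets borel"
  shows "1 \<le> survival A n x + (\<Sum>t=1..n. emeasure (kernel_pow P t x) A)"
proof (induction n arbitrary: x)
  case (Suc n)
  have ck: "emeasure (kernel_pow P (Suc t) x) A = (\<integral>\<^sup>+y. emeasure (kernel_pow P t y) A \<partial>P x)" for t
    using emeasure_kernel_pow_add[OF assms, of "Suc 0" t x] unfolding kernel_pow_1 by simp
  have "1 = (\<integral>\<^sup>+y. 1 \<partial>P x)" by simp
  also have "\<dots> \<le> (\<integral>\<^sup>+y. survival A n y * indicator (- A) y + indicator A y +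
      (\<Sum>t=1..n. emeasure (kernel_pow P t y) A) \<partial>P x)"
    by (rule nn_integral_mono) (use Suc in \<open>auto split: split_indicator simp: add_increasing2\<close>)
  also have "\<dots> = survival A (Suc n) x + emeasure (P x) A + (\<Sum>t=1..n. \<integral>\<^sup>+y. emeasure (kernel_pow P t y) A \<partial>P x)"
    by (simp add: nn_integral_add nn_integral_sum survival_Suc)
  also have "\<dots> = survival A (Suc n) x + (emeasure (kernel_pow P (Suc 0) x) A + (\<Sum>t=1..n. emeasure (kernel_pow P (Suc t) x) A))"
    unfolding ck kernel_pow_1 by (simp add: add.assoc)
  also have "(emeasure (kernel_pow P (Suc 0) x) A + (\<Sum>t=1..n. emeasure (kernel_pow P (Suc t) x) A)) =
     (\<Sum>t=1..Suc n. emeasure (kernel_pow P t x) A)"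
    by (simp add: sum.shift_bounds_cl_Suc_ivl sum.atLeast_Suc_atMost[of 0 n] del: sum.cl_ivl_Suc kernel_pow.simps)
  finally show ?case .
qed simp

end

section \<open>Hitting a positive set from a small set\<close>

context markov_kernel
begin

text \<open>
  The minorizing measure \<open>\<nu>\<close> charges some set \<open>E\<close> from which \<open>A\<close> is hit at a fixed time with
  probability bounded below, since countably many such sets cover the space. A point of
  \<open>C\<close> either lies in \<open>E\<close> already or is carried to \<open>E\<close> with a weighted total probability bounded
  below. Apart from the weight of time \<open>0\<close>, which may be infinite, the weights are summable because their
  mean is finite, so that late times can be cut off uniformly in the starting point.
\<close>

lemma small_set_reaches:
  assumes C: "small_set P C"
    and A [measurable]: "A \<in> sets borel"
    and reach: "\<And>x. \<exists>s>0. emeasure (kernel_pow P s x) A > 0"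
  obtains N c where "0 < c" "\<And>x. x \<in> C \<Longrightarrow> \<exists>t\<in>{1..N}. ennreal c \<le> emeasure (kernel_pow P t x) A"
proof -
  obtain \<epsilon> \<nu> and m :: "nat measure" where "\<epsilon> > 0"
    and sets_\<nu> [measurable_cong]: "sets \<nu> = sets borel" and \<nu>: "prob_space \<nu>" and m: "sets m = UNIV"
    and mean: "(\<integral>\<^sup>+t. of_nat t \<partial>m) < \<infinity>"
    and minor: "\<And>x A. A \<in> sets borel \<Longrightarrow>
      ennreal \<epsilon> * indicator C x * emeasure \<nu> A \<le> (\<Sum>t. emeasure (kernel_pow P t x) A * emeasure m {t})"
    using C unfolding small_set_def by blast
  interpret \<nu>: prob_space \<nu> by (rule \<nu>)
  define E where "E s k = {y. ennreal (1 / Suc k) \<le> emeasure (kernel_pow P (Suc s) y) A}" for s k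
  have E_meas [measurable]: "E s k \<in> sets borel" for s k
  proof -
    have "{y \<in> space borel. ennreal (1 / Suc k) \<le> emeasure (kernel_pow P (Suc s) y) A} \<in> sets borel"
      by measurable
    then show ?thesis by (simp add: E_def)
  qed
  have "\<exists>s k. emeasure \<nu> (E s k) > 0"
  proof (rule ccontr)
    assume "\<not> ?thesis"
    then have "E s k \<in> null_sets \<nu>" for s k
      by (auto simp: sets_\<nu>)
    then have "(\<Union>s. \<Union>k. E s k) \<in> null_sets \<nu>"
      by (intro null_sets_UN')  auto
    moreover have "(\<Union>s. \<Union>k. E s k) = UNIV"
    proof (intro equalityI subsetI UNIV_I)
      fix x
      obtain s where s: "s > 0" "emeasure (kernel_pow P s x) A > 0"
        using reach by blast
      define r where "r = measure (kernel_pow P s x) A"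
      interpret K: prob_space "kernel_pow P s x" by (rule prob_space_kernel_pow)
      have r: "emeasure (kernel_pow P s x) A = ennreal r"
        by (simp add: r_def K.emeasure_eq_measure)
      with s have "r > 0" by simp
      then obtain k where "1 / real (Suc k) < r"
        using nat_approx_posE by blast
      then have "x \<in> E (s - 1) k"
        using s r by (simp add: E_def del: kernel_pow.simps)
      then show "x \<in> (\<Union>s. \<Union>k. E s k)" by blast
    qed
    moreover have "space \<nu> = UNIV"
      using sets_eq_imp_space_eq[OF sets_\<nu>] by simp
    ultimately show False
      using \<nu>.emeasure_space_1 by (auto dest: null_setsD1)
  qed
  then obtain s k where \<nu>E: "emeasure \<nu> (E s k) > 0" by blast
  define \<delta> where "\<delta> = 1 / real (Suc k)"
  have "\<delta> > 0" by (simp add: \<delta>_def)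
  define q where "q = \<epsilon> * measure \<nu> (E s k)"
  have "q > 0"
    using \<nu>E \<open>\<epsilon> > 0\<close> by (simp add: q_def \<nu>.emeasure_eq_measure)
  have q: "ennreal \<epsilon> * emeasure \<nu> (E s k) = ennreal q"
    using \<open>\<epsilon> > 0\<close> by (simp add: q_def \<nu>.emeasure_eq_measure ennreal_mult)
  define w where "w t = enn2real (emeasure m {Suc t})" for t
  have sm: "space m = UNIV"
    using sets.top[of m] sets.sets_into_space[of UNIV m] m by auto
  have "(\<Sum>t. emeasure m {Suc t}) = emeasure m (\<Union>t. {Suc t})"
    by (rule suminf_emeasure) (auto simp: m disjoint_family_on_def)
  also have "\<dots> = (\<integral>\<^sup>+t. indicator (\<Union>t. {Suc t}) t \<partial>m)"
    by (simp add: m)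
  also have "\<dots> \<le> (\<integral>\<^sup>+t. of_nat t \<partial>m)"
    by (rule nn_integral_mono) (auto split: split_indicator)
  finally have fin: "(\<Sum>t. emeasure m {Suc t}) < \<infinity>"
    using mean by (rule le_less_trans)
  have w: "emeasure m {Suc t} = ennreal (w t)" for t
  proof -
    have "emeasure m {Suc t} \<le> (\<Sum>t. emeasure m {Suc t})"
      using sum_le_suminf[of "\<lambda>t. emeasure m {Suc t}" "{t}"] by simp
    then show ?thesis
      using fin by (simp add: w_def)
  qed
  have w0: "0 \<le> w t" for t by (simp add: w_def)
  have sw: "summable w"
    using fin by (intro summable_suminf_not_top w0) (simp add: w)
  obtain T where T: "norm (\<Sum>i. w (i + T)) < q / 2"
    using suminf_exist_split[of "q / 2" w] sw \<open>q > 0\<close> by auto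
  define c1 where "c1 = q / 2 / (suminf w + 1)"
  have w_nn: "0 \<le> suminf w" using sw w0 by (simp add: suminf_nonneg)
  have "c1 > 0" using \<open>q > 0\<close> w_nn by (simp add: c1_def)
  \<comment> \<open>Outside \<open>E\<close> the term of time \<open>0\<close> vanishes, whatever its weight is.\<close>
  have key: "\<exists>t<T. c1 \<le> measure (kernel_pow P (Suc t) x) (E s k)" if "x \<in> C" "x \<notin> E s k" for x
  proof (rule ccontr)
    assume neg: "\<not> ?thesis"
    define p where "p t = measure (kernel_pow P (Suc t) x) (E s k)" for t
    have p: "emeasure (kernel_pow P (Suc t) x) (E s k) = ennreal (p t)" for t
      unfolding p_def
      by (rule finite_measure.emeasure_eq_measure)
        (rule prob_space.finite_measure[OF prob_space_kernel_pow])
    have p01: "0 \<le> p t" "p t \<le> 1" for t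
      using prob_space.prob_le_1[OF prob_space_kernel_pow] by (auto simp: p_def simp del: kernel_pow.simps)
    have pw: "summable (\<lambda>t. p t * w t)"
      by (rule summable_comparison_test[OF _ sw])
        (auto intro!: exI[of _ 0] mult_left_le_one_le simp: w0 p01 abs_mult)
    have "ennreal q \<le> (\<Sum>t. emeasure (kernel_pow P t x) (E s k) * emeasure m {t})"
      using minor[of "E s k" x] that by (simp add: q)
    also have "\<dots> = (\<Sum>t. emeasure (kernel_pow P (Suc t) x) (E s k) * emeasure m {Suc t})"
      using that by (subst suminf_offset[of _ 1]) (auto simp del: kernel_pow.simps simp: kernel_pow.simps(1))
    also have "\<dots> = (\<Sum>t. ennreal (p t * w t))"
      by (simp add: p w ennreal_mult p01 w0 del: kernel_pow.simps)
    also have "\<dots> = ennreal (\<Sum>t. p t * w t)"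
      by (rule suminf_ennreal2) (auto simp: p01 w0 pw)
    finally have "q \<le> (\<Sum>t. p t * w t)"
      using \<open>q > 0\<close> by (subst (asm) ennreal_le_iff) (auto intro!: suminf_nonneg pw simp: p01 w0)
    also have "\<dots> = (\<Sum>t. p (t + T) * w (t + T)) + (\<Sum>t<T. p t * w t)"
      by (rule suminf_split_initial_segment[OF pw])
    also have "(\<Sum>t. p (t + T) * w (t + T)) \<le> (\<Sum>t. w (t + T))"
      using sw pw
      by (intro suminf_le) (auto intro: mult_left_le_one_le simp: p01 w0 summable_iff_shift[of "\<lambda>t. p t * w t"])
    also have "(\<Sum>t<T. p t * w t) \<le> (\<Sum>t<T. c1 * w t)"
      using neg by (intro sum_mono mult_right_mono) (auto simp: w0 p_def not_le simp del: kernel_pow.simps intro: less_imp_le)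
    also have "(\<Sum>t<T. c1 * w t) \<le> c1 * suminf w"
      using \<open>c1 > 0\<close> sw w0 by (simp add: sum_distrib_left[symmetric] sum_le_suminf)
    also have "c1 * suminf w \<le> q / 2"
      using \<open>q > 0\<close> w_nn by (simp add: c1_def field_simps)
    finally show False
      using T by simp
  qed
  show thesis
  proof (rule that)
    show "0 < min \<delta> (c1 * \<delta>)" using \<open>\<delta> > 0\<close> \<open>c1 > 0\<close> by simp
    fix x assume "x \<in> C"
    show "\<exists>t\<in>{1..T + Suc s}. ennreal (min \<delta> (c1 * \<delta>)) \<le> emeasure (kernel_pow P t x) A"
    proof (cases "x \<in> E s k")
      case True
      have "ennreal (min \<delta> (c1 * \<delta>)) \<le> ennreal \<delta>"
        by (rule ennreal_leI) simp
      also have "\<dots> \<le> emeasure (kernel_pow P (Suc s) x) A"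
        using True by (simp add: E_def \<delta>_def del: kernel_pow.simps)
      finally show ?thesis by (intro bexI[of _ "Suc s"]) auto
    next
      case False
      then obtain t where t: "t < T" "c1 \<le> measure (kernel_pow P (Suc t) x) (E s k)"
        using key \<open>x \<in> C\<close> by blast
      have "ennreal (min \<delta> (c1 * \<delta>)) \<le> ennreal \<delta> * ennreal c1"
        using \<open>\<delta> > 0\<close> \<open>c1 > 0\<close> by (subst ennreal_mult[symmetric]) (auto intro!: ennreal_leI simp: mult.commute)
      also have "\<dots> \<le> ennreal \<delta> * emeasure (kernel_pow P (Suc t) x) (E s k)"
        using t(2) finite_measure.emeasure_eq_measure[OF prob_space.finite_measure[OF prob_space_kernel_pow]]
        by (intro mult_left_mono) (auto intro!: ennreal_leI simp del: kernel_pow.simps)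
      also have "\<dots> = (\<integral>\<^sup>+y. ennreal \<delta> * indicator (E s k) y \<partial>kernel_pow P (Suc t) x)"
        by (rule nn_integral_cmult_indicator[symmetric]) (simp del: kernel_pow.simps)
      also have "\<dots> \<le> (\<integral>\<^sup>+y. emeasure (kernel_pow P (Suc s) y) A \<partial>kernel_pow P (Suc t) x)"
        by (rule nn_integral_mono) (auto simp: E_def \<delta>_def split: split_indicator simp del: kernel_pow.simps)
      also have "\<dots> = emeasure (kernel_pow P (Suc t + Suc s) x) A"
        by (rule emeasure_kernel_pow_add[symmetric]) simp
      finally show ?thesis
        using t(1) by (intro bexI[of _ "Suc t + Suc s"]) auto
    qed
  qed
qed

lemma survival_le_1: "survival A n x \<le> 1"
  using survival_antimono[of 0 n A x] by simp

lemma small_set_survival: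
  assumes "small_set P C" and A: "A \<in> sets borel"
    and "\<And>x. \<exists>s>0. emeasure (kernel_pow P s x) A > 0"
  obtains N c where "0 < c" "c < 1" "\<And>x. x \<in> C \<Longrightarrow> survival A N x \<le> ennreal (1 - c)"
proof -
  obtain N c where c: "0 < c" and N: "\<And>x. x \<in> C \<Longrightarrow> \<exists>t\<in>{1..N}. ennreal c \<le> emeasure (kernel_pow P t x) A"
    using small_set_reaches[OF assms] by blast
  define c' where "c' = min c (1/2)"
  have c': "0 < c'" "c' < 1" "c' \<le> c" using c by (auto simp: c'_def)
  have "survival A N x \<le> ennreal (1 - c')" if "x \<in> C" for x
  proof -
    obtain t where t: "t \<in> {1..N}" "ennreal c \<le> emeasure (kernel_pow P t x) A"
      using N[OF \<open>x \<in> C\<close>] by auto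
    then obtain t' where t': "t = Suc t'" by (cases t) auto
    have "ennreal c' \<le> emeasure (kernel_pow P t x) A"
      using t(2) c' by (auto intro: order_trans[OF ennreal_leI])
    then have "survival A t x + ennreal c' \<le> 1"
      using survival_add_hit_le[OF A, of t' x] unfolding t'
      by (meson add_left_mono order_trans)
    moreover obtain u where u: "0 \<le> u" "survival A t x = ennreal u"
      using survival_le_1[of A t x] by (cases "survival A t x" rule: ennreal_cases) (auto simp: top_unique)
    ultimately have "ennreal (u + c') \<le> ennreal 1"
      using c' by (simp add: ennreal_plus)
    then have "u + c' \<le> 1"
      by (simp only: ennreal_le_iff[OF zero_le_one])
    then have "survival A t x \<le> ennreal (1 - c')"
      unfolding u by (intro ennreal_leI) simp
    then show ?thesis
      using survival_antimono[of t N A x] t(1) by (auto intro: order_trans)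
  qed
  then show thesis using that c' by blast
qed

end

section \<open>Supersolutions\<close>

lemma ln_ext_le_iff: "ln_ext c \<le> ereal r \<longleftrightarrow> c \<le> ennreal (exp r)"
proof (cases c rule: ennreal_cases)
  case (real u)
  have "ln u \<le> r \<longleftrightarrow> u \<le> exp r" if "u > 0"
    using that exp_le_cancel_iff[of "ln u" r] by simp
  with real show ?thesis
    by (cases "u = 0") (auto simp: ln_ext_def ennreal_eq_0_iff)
next
  case top
  then show ?thesis by (simp add: ln_ext_def top_unique)
qed

text \<open>
  Drift inequalities are used only in this multiplicative form.
\<close>

lemma nonlinear_generator_le_iff:
  "nonlinear_generator P V x \<le> ereal r \<longleftrightarrow> (\<integral>\<^sup>+y. ennreal (exp (V y)) \<partial>P x) \<le> ennreal (exp (V x + r))"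
    (is "_ \<longleftrightarrow> ?I \<le> _")
proof -
  have cancel: "ennreal (exp (V x)) * (ennreal (exp (- V x)) * c) = c" for c
    unfolding mult.assoc[symmetric] by (simp add: ennreal_mult[symmetric] exp_add[symmetric])
  have cancel': "ennreal (exp (- V x)) * (ennreal (exp (V x)) * c) = c" for c
    unfolding mult.assoc[symmetric] by (simp add: ennreal_mult[symmetric] exp_add[symmetric])
  have "ennreal (exp (V x + r)) = ennreal (exp (V x)) * ennreal (exp r)"
    by (simp add: exp_add ennreal_mult)
  then show ?thesis
    unfolding nonlinear_generator_def ln_ext_le_iff
    using mult_left_mono[of "ennreal (exp (- V x)) * ?I" "ennreal (exp r)" "ennreal (exp (V x))"]
      mult_left_mono[of ?I "ennreal (exp (V x)) * ennreal (exp r)" "ennreal (exp (- V x))"]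
    by (auto simp: cancel cancel')
qed

context markov_kernel
begin

lemma weighted_step_partition:
  assumes [measurable]: "A \<in> sets borel" "f \<in> borel_measurable borel" "g \<in> borel_measurable borel"
  shows "weighted_step P a A f x + weighted_step P a (- A) g x =
    a x * (\<integral>\<^sup>+y. (if y \<in> A then f y else g y) \<partial>P x)"
proof -
  have "(\<integral>\<^sup>+y. (if y \<in> A then f y else g y) \<partial>P x) = (\<integral>\<^sup>+y. f y * indicator A y + g y * indicator (- A) y \<partial>P x)"
    by (rule nn_integral_cong) auto
  also have "\<dots> = (\<integral>\<^sup>+y. f y * indicator A y \<partial>P x) + (\<integral>\<^sup>+y. g y * indicator (- A) y \<partial>P x)"
    by (rule nn_integral_add) auto
  finally show ?thesis
    by (simp add: weighted_step_def distrib_left)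
qed

text \<open>
  The function \<open>z = 1 + (\<Sum>j<N. survival A j)\<close> is \<open>1 + E[min \<tau> N]\<close>. One step of the killed chain turns
  each summand into the next one, so the sum telescopes and decreases by the probability of hitting
  \<open>A\<close> within \<open>N\<close> steps: by at least \<open>0\<close> everywhere and by at least \<open>c\<close> on \<open>C\<close>. As \<open>z \<le> 1 + N\<close>,
  an additive decrease \<open>c\<close> is a decrease by the factor \<open>1 - c / (1 + N) = e\<^bsup>-\<beta>\<^esup>\<close>.
\<close>

lemma exists_bounded_supersolution:
  assumes A [measurable]: "A \<in> sets borel" and C: "0 < c" "c < 1" "\<And>x. x \<in> C \<Longrightarrow> survival A N x \<le> ennreal (1 - c)"
  obtains s \<beta> :: real and z where "\<beta> > 0" "s \<ge> 1" "z \<in> borel_measurable borel"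
    "\<And>x. 1 \<le> z x" "\<And>x. z x \<le> s"
    "\<And>x. (\<integral>\<^sup>+y. ennreal (if y \<in> A then 1 else z y) \<partial>P x) \<le> ennreal (z x * exp (- \<beta> * indicator C x))"
proof -
  define h where "h j x = enn2real (survival A j x)" for j x
  have h: "survival A j x = ennreal (h j x)" for j x
    using survival_antimono[of 0 j A x]
    by (cases "survival A j x" rule: ennreal_cases) (auto simp: h_def top_unique)
  have h01: "0 \<le> h j x" "h j x \<le> 1" for j x
    using survival_antimono[of 0 j A x] unfolding h by (simp_all add: h_def)
  have [measurable]: "h j \<in> borel_measurable borel" for j
    unfolding h_def[abs_def] by measurable
  define z where "z x = 1 + (\<Sum>j<N. h j x)" for x
  have z1: "1 \<le> z x" for x
    by (simp add: z_def sum_nonneg h01)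
  have zN: "z x \<le> 1 + real N" for x
    using sum_mono[of "{..<N}" "\<lambda>j. h j x" "\<lambda>_. 1"] by (simp add: z_def h01)
  have z_survival: "ennreal (z x) = 1 + (\<Sum>j<N. survival A j x)" for x
  proof -
    have "(\<Sum>j<N. survival A j x) = ennreal (\<Sum>j<N. h j x)"
      unfolding h by (rule sum_ennreal) (rule h01)
    then show ?thesis
      using ennreal_plus[of 1 "\<Sum>j<N. h j x"] by (simp add: z_def sum_nonneg h01(1))
  qed
  have step: "(\<integral>\<^sup>+y. ennreal (if y \<in> A then 1 else z y) \<partial>P x) = ennreal (z x + h N x - 1)" for x
  proof -
    have "(\<integral>\<^sup>+y. ennreal (if y \<in> A then 1 else z y) \<partial>P x) =
        (\<integral>\<^sup>+y. 1 + (\<Sum>j<N. survival A j y * indicator (- A) y) \<partial>P x)"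
    proof (rule nn_integral_cong)
      show "ennreal (if y \<in> A then 1 else z y) = 1 + (\<Sum>j<N. survival A j y * indicator (- A) y)" for y
        by (cases "y \<in> A") (simp_all only: z_survival if_True if_False indicator_simps Compl_iff not_not simp_thms
            mult_1_right mult_zero_right sum.neutral_const add_0_right ennreal_1)
    qed
    also have "\<dots> = 1 + (\<Sum>j<N. survival A (Suc j) x)"
    proof -
      have "(\<integral>\<^sup>+y. 1 + (\<Sum>j<N. survival A j y * indicator (- A) y) \<partial>P x) =
          (\<integral>\<^sup>+y. 1 \<partial>P x) + (\<integral>\<^sup>+y. (\<Sum>j<N. survival A j y * indicator (- A) y) \<partial>P x)"
        by (rule nn_integral_add) measurable
      also have "(\<integral>\<^sup>+y. (\<Sum>j<N. survival A j y * indicator (- A) y) \<partial>P x) =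
          (\<Sum>j<N. \<integral>\<^sup>+y. survival A j y * indicator (- A) y \<partial>P x)"
        by (rule nn_integral_sum) measurable
      finally show ?thesis
        by (simp only: survival_Suc nn_integral_const space_kernel emeasure_kernel_UNIV mult_1)
    qed
    also have "(\<Sum>j<N. survival A (Suc j) x) = ennreal (\<Sum>j<N. h (Suc j) x)"
      unfolding h by (rule sum_ennreal) (rule h01)
    also have "1 + ennreal (\<Sum>j<N. h (Suc j) x) = ennreal (1 + (\<Sum>j<N. h (Suc j) x))"
      using ennreal_plus[of 1 "\<Sum>j<N. h (Suc j) x"] by (simp add: sum_nonneg h01(1))
    also have "1 + (\<Sum>j<N. h (Suc j) x) = z x + h N x - 1"
    proof -
      have "h 0 x = 1" by (simp add: h_def)
      then show ?thesis
        unfolding z_def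
        using sum.lessThan_Suc_shift[of "\<lambda>j. h j x" N] sum.lessThan_Suc[of "\<lambda>j. h j x" N]
        by linarith
    qed
    finally show ?thesis .
  qed
  \<comment> \<open>The bound \<open>1 + N\<close> of \<open>z\<close> turns the additive decrease into a factor.\<close>
  define \<kappa> where "\<kappa> = 1 - c / (1 + real N)"
  have "c / (1 + real N) \<le> c / 1"
    using C by (intro divide_left_mono) auto
  then have \<kappa>: "0 < \<kappa>" "\<kappa> < 1"
    using C by (auto simp: \<kappa>_def)
  show thesis
  proof (rule that)
    show "0 < - ln \<kappa>" using \<kappa> by simp
    show "1 \<le> 1 + real N" by simp
    show "z \<in> borel_measurable borel" unfolding z_def[abs_def] by measurable
    show "1 \<le> z x" "z x \<le> 1 + real N" for x by (fact z1 zN)+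
    show "(\<integral>\<^sup>+y. ennreal (if y \<in> A then 1 else z y) \<partial>P x) \<le> ennreal (z x * exp (- (- ln \<kappa>) * indicator C x))" for x
    proof (cases "x \<in> C")
      case True
      have "h N x \<le> 1 - c"
        using C True by (simp add: h)
      moreover have "c * z x / (1 + real N) \<le> c"
        using mult_left_mono[OF zN[of x], of c] C by (simp add: field_simps)
      moreover have "z x * \<kappa> = z x - c * z x / (1 + real N)"
        by (simp add: \<kappa>_def algebra_simps)
      ultimately show ?thesis
        unfolding step using True \<kappa> by (auto intro: ennreal_leI)
    next
      case False
      then show ?thesis
        unfolding step using h01[of N x] by (auto intro: ennreal_leI)
    qed
  qed
qed

text \<open>
  Interpolation of two supersolutions. Normalizing \<open>e\<^sup>V\<close> and \<open>z\<close> by the bounds \<open>r1\<close> and \<open>r2\<close> on their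
  integrals, the weighted inequality of arithmetic and geometric means estimates the geometric mean by a
  convex combination of two functions with integral at most \<open>1\<close>.
\<close>

lemma multiplicative_supersolution:
  assumes [measurable]: "A \<in> sets borel" "V \<in> borel_measurable borel" "z \<in> borel_measurable borel"
    and z: "\<And>x. 1 \<le> z x"
    and V: "(\<integral>\<^sup>+y. ennreal (exp (V y)) \<partial>P x) \<le> ennreal r1"
    and Z: "(\<integral>\<^sup>+y. ennreal (if y \<in> A then 1 else z y) \<partial>P x) \<le> ennreal r2"
    and r: "r1 > 0" "r2 > 0" and \<eta>: "0 \<le> \<eta>" "\<eta> \<le> 1"
  shows "(\<integral>\<^sup>+y. ennreal (exp (\<eta> * V y) * (if y \<in> A then 1 else z y powr (1 - \<eta>))) \<partial>P x)
    \<le> ennreal (r1 powr \<eta> * r2 powr (1 - \<eta>))"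
proof -
  let ?z = "\<lambda>y. if y \<in> A then 1 else z y"
  let ?k = "r1 powr \<eta> * r2 powr (1 - \<eta>)"
  have zp: "?z y > 0" for y using less_le_trans[OF zero_less_one z[of y]] by simp
  have pt: "exp (\<eta> * V y) * (if y \<in> A then 1 else z y powr (1 - \<eta>))
      \<le> ?k * \<eta> / r1 * exp (V y) + ?k * (1 - \<eta>) / r2 * ?z y" for y
  proof -
    have "exp (\<eta> * V y) * (if y \<in> A then 1 else z y powr (1 - \<eta>)) = exp (V y) powr \<eta> * ?z y powr (1 - \<eta>)"
      by (simp add: exp_powr_real mult.commute)
    also have "\<dots> = ?k * ((exp (V y) / r1) powr \<eta> * (?z y / r2) powr (1 - \<eta>))"
      using r zp[of y] by (simp add: powr_divide)
    also have "\<dots> \<le> ?k * (\<eta> * (exp (V y) / r1) + (1 - \<eta>) * (?z y / r2))"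
      using r zp[of y] \<eta> by (intro mult_left_mono Youngs_inequality_0) auto
    finally show ?thesis by (simp add: algebra_simps)
  qed
  have k: "0 \<le> ?k" by simp
  have "(\<integral>\<^sup>+y. ennreal (exp (\<eta> * V y) * (if y \<in> A then 1 else z y powr (1 - \<eta>))) \<partial>P x)
    \<le> (\<integral>\<^sup>+y. ennreal (?k * \<eta> / r1) * ennreal (exp (V y)) + ennreal (?k * (1 - \<eta>) / r2) * ennreal (?z y) \<partial>P x)"
  proof (rule nn_integral_mono)
    fix y
    have "ennreal (?k * \<eta> / r1) * ennreal (exp (V y)) + ennreal (?k * (1 - \<eta>) / r2) * ennreal (?z y)
      = ennreal (?k * \<eta> / r1 * exp (V y) + ?k * (1 - \<eta>) / r2 * ?z y)"
      using k r \<eta> zp[of y]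
      by (subst ennreal_plus) (auto simp: ennreal_mult[symmetric] simp del: ennreal_plus intro!: mult_nonneg_nonneg divide_nonneg_pos)
    then show "ennreal (exp (\<eta> * V y) * (if y \<in> A then 1 else z y powr (1 - \<eta>)))
      \<le> ennreal (?k * \<eta> / r1) * ennreal (exp (V y)) + ennreal (?k * (1 - \<eta>) / r2) * ennreal (?z y)"
      using pt[of y] by (simp only: ennreal_leI)
  qed
  also have "\<dots> = ennreal (?k * \<eta> / r1) * (\<integral>\<^sup>+y. ennreal (exp (V y)) \<partial>P x)
      + ennreal (?k * (1 - \<eta>) / r2) * (\<integral>\<^sup>+y. ennreal (?z y) \<partial>P x)"
    by (simp add: nn_integral_add nn_integral_cmult)
  also have "\<dots> \<le> ennreal (?k * \<eta> / r1) * ennreal r1 + ennreal (?k * (1 - \<eta>) / r2) * ennreal r2"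
    by (intro add_mono mult_left_mono V Z) auto
  also have "\<dots> = ennreal (?k * \<eta> / r1 * r1 + ?k * (1 - \<eta>) / r2 * r2)"
    using k r \<eta>
    by (subst ennreal_plus) (auto simp: ennreal_mult[symmetric] simp del: ennreal_plus intro!: mult_nonneg_nonneg divide_nonneg_pos)
  also have "?k * \<eta> / r1 * r1 + ?k * (1 - \<eta>) / r2 * r2 = ?k"
  proof -
    have "?k * \<eta> / r1 * r1 = ?k * \<eta>" "?k * (1 - \<eta>) / r2 * r2 = ?k * (1 - \<eta>)"
      using r by simp_all
    then show ?thesis
      by (simp only: distrib_left[symmetric]) simp
  qed
  finally show ?thesis .
qed

lemma survival_tendsto_0_of_bound:
  assumes bound: "\<And>n. ennreal (exp (\<epsilon> * real n)) * survival A n x \<le> K" and "K < \<infinity>" "\<epsilon> > 0"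
  shows "(\<lambda>n. survival A n x) \<longlonglongrightarrow> 0"
proof -
  obtain k where k: "K = ennreal k" "0 \<le> k"
    using \<open>K < \<infinity>\<close> by (cases K rule: ennreal_cases) auto
  have "(\<lambda>n. k * exp (- \<epsilon>) ^ n) \<longlonglongrightarrow> k * 0"
    using \<open>\<epsilon> > 0\<close> by (intro tendsto_mult tendsto_const LIMSEQ_realpow_zero) auto
  then have lim: "(\<lambda>n. ennreal (k * exp (- \<epsilon>) ^ n)) \<longlonglongrightarrow> 0"
    using tendsto_ennrealI[of "\<lambda>n. k * exp (- \<epsilon>) ^ n" 0] by simp
  have upper: "survival A n x \<le> ennreal (k * exp (- \<epsilon>) ^ n)" for n
  proof -
    have e: "exp (- \<epsilon>) ^ n = exp (- (\<epsilon> * real n))"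
      by (simp add: exp_of_nat_mult[symmetric] mult.commute)
    have "survival A n x = ennreal (exp (- (\<epsilon> * real n))) * (ennreal (exp (\<epsilon> * real n)) * survival A n x)"
      unfolding mult.assoc[symmetric] by (simp add: ennreal_mult[symmetric] exp_add[symmetric])
    also have "\<dots> \<le> ennreal (exp (- (\<epsilon> * real n))) * K"
      by (intro mult_left_mono bound) auto
    finally show ?thesis
      using k by (simp add: e ennreal_mult[symmetric] mult.commute)
  qed
  show ?thesis
  proof (rule tendsto_sandwich)
    show "\<forall>\<^sub>F n in sequentially. 0 \<le> survival A n x" by simp
    show "\<forall>\<^sub>F n in sequentially. survival A n x \<le> ennreal (k * exp (- \<epsilon>) ^ n)"
      by (rule always_eventually) (rule allI, rule upper)
    show "(\<lambda>n. 0) \<longlonglongrightarrow> (0 :: ennreal)" by (rule tendsto_const)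
  qed (rule lim)
qed

text \<open>
  Iterating the supersolution inequality gives \<open>e\<^bsup>\<epsilon>n\<^esup> \<cdot> survival A n \<le> S\<close>, because \<open>S\<close> is bounded
  below by \<open>1\<close>.
\<close>

lemma survival_tendsto_0:
  assumes [measurable]: "A \<in> sets borel"
    and S: "\<And>x. 1 \<le> S x" and fin: "S x < \<infinity>" and "\<epsilon> > 0"
    and step: "\<And>x. ennreal (exp \<epsilon>) * (\<integral>\<^sup>+y. S y * indicator (- A) y \<partial>P x) \<le> S x"
  shows "(\<lambda>n. survival A n x) \<longlonglongrightarrow> 0"
proof -
  have bound: "ennreal (exp (\<epsilon> * real n)) * survival A n x \<le> S x" for n x
  proof (induction n arbitrary: x)
    case (Suc n)
    have "ennreal (exp (\<epsilon> * real (Suc n))) * survival A (Suc n) x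
      = ennreal (exp \<epsilon>) * (ennreal (exp (\<epsilon> * real n)) * (\<integral>\<^sup>+y. survival A n y * indicator (- A) y \<partial>P x))"
      by (simp add: survival_Suc distrib_left exp_add ennreal_mult mult.assoc)
    also have "\<dots> = ennreal (exp \<epsilon>) * (\<integral>\<^sup>+y. (ennreal (exp (\<epsilon> * real n)) * survival A n y) * indicator (- A) y \<partial>P x)"
      by (simp add: nn_integral_cmult mult.assoc)
    also have "\<dots> \<le> ennreal (exp \<epsilon>) * (\<integral>\<^sup>+y. S y * indicator (- A) y \<partial>P x)"
      by (intro mult_left_mono nn_integral_mono mult_right_mono Suc) auto
    finally show ?case using step order_trans by blast
  qed (simp add: S)
  show ?thesis
    by (rule survival_tendsto_0_of_bound[OF bound fin \<open>\<epsilon> > 0\<close>])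
qed

end

section \<open>Exponential bounds from the drift condition\<close>

lemma L_infty_dominated:
  assumes "H \<in> L_infty W" "\<And>x. H x \<ge> 1" "\<And>x. W x \<ge> 1"
  obtains k where "0 < k" "\<And>x. H x \<le> k * W x"
proof -
  have "(SUP x. ereal (\<bar>H x\<bar> / W x)) \<noteq> \<infinity>"
    using assms(1) by (simp add: L_infty_def)
  then obtain k where k: "(SUP x. ereal (\<bar>H x\<bar> / W x)) \<le> ereal k"
    by (cases "SUP x. ereal (\<bar>H x\<bar> / W x)") auto
  have "ereal (\<bar>H x\<bar> / W x) \<le> ereal k" for x
    using k by (rule order_trans[OF SUP_upper[OF UNIV_I]])
  then have "\<bar>H x\<bar> / W x \<le> k" for x by simp
  then have le: "\<bar>H x\<bar> \<le> k * W x" for x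
    using assms(3)[of x] by (simp add: divide_le_eq)
  have "1 \<le> \<bar>H x\<bar>" for x using assms(2)[of x] by simp
  then have "0 < k * W undefined" using le less_le_trans[OF zero_less_one] order_trans by blast
  then have "0 < k" using assms(3)[of undefined] by (simp add: zero_less_mult_iff)
  moreover have "H x \<le> k * W x" for x using le[of x] by simp
  ultimately show thesis by (rule that)
qed

context markov_kernel
begin

text \<open>
  Domination of \<open>H\<close> by \<open>W\<close> allows the drift to be written in terms of \<open>H\<close>, and \<open>b\<close> may be enlarged to be
  nonnegative.
\<close>

lemma DV3_imp_drift:
  assumes "DV3 P V W" "H \<in> L_infty W" and H: "\<And>x. H x \<ge> 1"
  obtains C d b where "small_set P C" "0 < d" "0 \<le> b"
    "\<And>x. (\<integral>\<^sup>+y. ennreal (exp (V y)) \<partial>P x) \<le> ennreal (exp (V x - d * H x + b * indicator C x))"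
proof -
  have W: "\<And>x. W x \<ge> 1" using assms(1) by (simp add: DV3_def)
  obtain k where k: "0 < k" "\<And>x. H x \<le> k * W x"
    by (rule L_infty_dominated[OF assms(2) H W]) (rule that)
  obtain C \<delta> b where C: "small_set P C" and "\<delta> > 0"
    and drift: "\<And>x. nonlinear_generator P V x \<le> ereal (- \<delta> * W x + b * indicator C x)"
    using assms(1) by (auto simp: DV3_def)
  show thesis
  proof (rule that[OF C])
    show "0 < \<delta> / k" using k \<open>\<delta> > 0\<close> by simp
    show "0 \<le> max 0 b" by simp
    fix x
    have "\<delta> / k * H x \<le> \<delta> / k * (k * W x)"
      using k \<open>\<delta> > 0\<close> by (intro mult_left_mono) auto
    also have "\<dots> = \<delta> * W x" using k by simp
    finally have "- \<delta> * W x + b * indicator C x \<le> - (\<delta> / k * H x) + max 0 b * indicator C x"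
      by (auto split: split_indicator)
    then have "nonlinear_generator P V x \<le> ereal (- (\<delta> / k * H x) + max 0 b * indicator C x)"
      using drift[of x] by (meson ereal_less_eq(3) order_trans)
    then show "(\<integral>\<^sup>+y. ennreal (exp (V y)) \<partial>P x) \<le> ennreal (exp (V x - \<delta> / k * H x + max 0 b * indicator C x))"
      unfolding nonlinear_generator_le_iff by (simp add: algebra_simps)
  qed
qed

text \<open>
  Interpolate between \<open>e\<^sup>V\<close>, whose drift fails on \<open>C\<close> by at most a factor \<open>e\<^sup>b\<close>, and the bounded
  supersolution \<open>z\<close>, whose drift gains the factor \<open>e\<^bsup>-\<beta>\<^esup>\<close> there.
\<close>

lemma DV3_exponential_bound:
  assumes DV3: "DV3 P V W" and HW: "H \<in> L_infty W"
    and H [measurable]: "H \<in> borel_measurable borel" and H1: "\<And>x. H x \<ge> 1"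
    and A [measurable]: "A \<in> sets borel"
    and reach: "\<And>x. \<exists>s>0. emeasure (kernel_pow P s x) A > 0"
  obtains \<epsilon> \<eta> B where "\<epsilon> > 0" "\<eta> \<le> 1" "\<eta> > 0"
    "\<And>x. (\<integral>\<^sup>+\<omega>. exp_ext (ereal \<epsilon> * path_sum H (return_time A \<omega>) \<omega>
        + ereal (\<eta> * V (\<omega> (the_enat (return_time A \<omega>))))) \<partial>path_law P x) \<le> ennreal (exp (\<eta> * V x + B))"
proof -
  have V [measurable]: "V \<in> borel_measurable borel" and V0: "\<And>x. V x > 0"
    using DV3 by (auto simp: DV3_def)
  obtain C d b where C: "small_set P C" and d: "0 < d" and b: "0 \<le> b"
    and drift: "\<And>x. (\<integral>\<^sup>+y. ennreal (exp (V y)) \<partial>P x) \<le> ennreal (exp (V x - d * H x + b * indicator C x))"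
    by (rule DV3_imp_drift[OF DV3 HW H1]) (rule that)
  obtain N c where c: "0 < c" "c < 1" "\<And>x. x \<in> C \<Longrightarrow> survival A N x \<le> ennreal (1 - c)"
    by (rule small_set_survival[OF C A reach]) (rule that)
  obtain s \<beta> :: real and z where \<beta>: "\<beta> > 0" and s: "s \<ge> 1" and z [measurable]: "z \<in> borel_measurable borel"
    and z1: "\<And>x. 1 \<le> z x" and zs: "\<And>x. z x \<le> s"
    and z_step: "\<And>x. (\<integral>\<^sup>+y. ennreal (if y \<in> A then 1 else z y) \<partial>P x) \<le> ennreal (z x * exp (- \<beta> * indicator C x))"
    by (rule exists_bounded_supersolution[where C = C, OF A c]) (assumption, rule that)
  have zp: "0 < z x" for x using less_le_trans[OF zero_less_one z1] .
  \<comment> \<open>This exponent makes the gain and the loss on \<open>C\<close> cancel.\<close>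
  define \<eta> where "\<eta> = \<beta> / (\<beta> + b)"
  have \<eta>: "0 < \<eta>" "\<eta> \<le> 1" using \<beta> b by (auto simp: \<eta>_def)
  have balance: "\<eta> * b = (1 - \<eta>) * \<beta>" using \<beta> b by (simp add: \<eta>_def field_simps)
  define \<epsilon> where "\<epsilon> = \<eta> * d"
  have \<epsilon>: "\<epsilon> > 0" using \<eta> d by (simp add: \<epsilon>_def)
  define S where "S x = exp (\<eta> * V x) * z x powr (1 - \<eta>)" for x
  have [measurable]: "S \<in> borel_measurable borel" unfolding S_def[abs_def] by measurable
  have S1: "1 \<le> S x" for x
  proof -
    have "1 \<le> exp (\<eta> * V x)" using V0[of x] \<eta> by simp
    moreover have "1 \<le> z x powr (1 - \<eta>)" using z1[of x] \<eta> by (simp add: ge_one_powr_ge_zero)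
    ultimately have "1 * 1 \<le> S x" unfolding S_def by (intro mult_mono) auto
    then show ?thesis by simp
  qed
  let ?U = "\<lambda>x. \<integral>\<^sup>+y. (if y \<in> A then ennreal (exp (\<eta> * V y)) else ennreal (S y)) \<partial>P x"
  have U: "?U x \<le> ennreal (S x * exp (- \<epsilon> * H x))" for x
  proof -
    let ?r1 = "exp (V x - d * H x + b * indicator C x)" and ?r2 = "z x * exp (- \<beta> * indicator C x)"
    have "?U x = (\<integral>\<^sup>+y. ennreal (exp (\<eta> * V y) * (if y \<in> A then 1 else z y powr (1 - \<eta>))) \<partial>P x)"
      by (rule nn_integral_cong) (auto simp: S_def)
    also have "\<dots> \<le> ennreal (?r1 powr \<eta> * ?r2 powr (1 - \<eta>))"
      using \<eta> zp by (intro multiplicative_supersolution A V z z1 drift z_step) auto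
    also have "?r1 powr \<eta> * ?r2 powr (1 - \<eta>) =
        exp (\<eta> * (V x - d * H x + b * indicator C x)) * (z x powr (1 - \<eta>) * exp ((1 - \<eta>) * (- \<beta> * indicator C x)))"
      using zp[of x] by (simp add: powr_mult exp_powr_real mult.commute[of _ \<eta>] mult.commute[of _ "1 - \<eta>"])
    also have "\<dots> = z x powr (1 - \<eta>) *
        exp (\<eta> * (V x - d * H x + b * indicator C x) + (1 - \<eta>) * (- \<beta> * indicator C x))"
      by (simp only: exp_add mult.left_commute)
    also have "\<eta> * (V x - d * H x + b * indicator C x) + (1 - \<eta>) * (- \<beta> * indicator C x) =
        \<eta> * V x + - \<epsilon> * H x + (\<eta> * b - (1 - \<eta>) * \<beta>) * indicator C x"
      by (simp add: \<epsilon>_def algebra_simps)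
    also have "z x powr (1 - \<eta>) * exp (\<dots>) = S x * exp (- \<epsilon> * H x)"
      by (simp add: balance S_def exp_add[symmetric] mult_ac)
    finally show ?thesis .
  qed
  define a where "a x = ennreal (exp (\<epsilon> * H x))" for x
  have [measurable]: "a \<in> borel_measurable borel" unfolding a_def[abs_def] by measurable
  define f where "f x = ennreal (exp (\<eta> * V x))" for x
  have [measurable]: "f \<in> borel_measurable borel" unfolding f_def[abs_def] by measurable
  have step: "weighted_step P a A f x + weighted_step P a (- A) (\<lambda>y. ennreal (S y)) x \<le> ennreal (S x)" for x
  proof -
    have "weighted_step P a A f x + weighted_step P a (- A) (\<lambda>y. ennreal (S y)) x = a x * ?U x"
      unfolding f_def by (rule weighted_step_partition) measurable
    also have "\<dots> \<le> a x * ennreal (S x * exp (- \<epsilon> * H x))"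
      by (intro mult_left_mono U) simp
    also have "\<dots> = ennreal (exp (\<epsilon> * H x) * (S x * exp (- \<epsilon> * H x)))"
      unfolding a_def using S1[of x] by (intro ennreal_mult[symmetric]) auto
    also have "exp (\<epsilon> * H x) * (S x * exp (- \<epsilon> * H x)) = S x"
      by (simp add: exp_minus field_simps)
    finally show ?thesis .
  qed
  have surv: "(\<lambda>n. survival A n x) \<longlonglongrightarrow> 0" for x
  proof (rule survival_tendsto_0[OF A _ _ \<epsilon>])
    show "1 \<le> ennreal (S x)" for x using S1 by simp
    show "ennreal (S x) < \<infinity>" by simp
    fix x
    have "ennreal (exp \<epsilon>) \<le> a x"
      unfolding a_def using H1[of x] \<epsilon> by (intro ennreal_leI) simp
    then have "ennreal (exp \<epsilon>) * (\<integral>\<^sup>+y. ennreal (S y) * indicator (- A) y \<partial>P x) \<le> weighted_step P a (- A) (\<lambda>y. ennreal (S y)) x"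
      unfolding weighted_step_def by (rule mult_right_mono) simp
    also have "\<dots> \<le> ennreal (S x)"
      using step[of x] by (rule order_trans[rotated]) simp
    finally show "ennreal (exp \<epsilon>) * (\<integral>\<^sup>+y. ennreal (S y) * indicator (- A) y \<partial>P x) \<le> ennreal (S x)" .
  qed
  show thesis
  proof (rule that[OF \<epsilon> \<eta>(2,1)])
    fix x
    have "(\<integral>\<^sup>+\<omega>. exp_ext (ereal \<epsilon> * path_sum H (return_time A \<omega>) \<omega>
        + ereal (\<eta> * V (\<omega> (the_enat (return_time A \<omega>))))) \<partial>path_law P x)
      = (\<Sum>n. (weighted_step P a (- A) ^^ n) (weighted_step P a A f) x)"
    proof (rule nn_integral_return_time[OF _ A _ _ surv])
      fix \<omega> n assume "return_time A \<omega> = enat (Suc n)"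
      then show "exp_ext (ereal \<epsilon> * path_sum H (return_time A \<omega>) \<omega> + ereal (\<eta> * V (\<omega> (the_enat (return_time A \<omega>)))))
        = (\<Prod>t<Suc n. a (\<omega> t)) * f (\<omega> (Suc n))"
        unfolding a_def f_def
        by (simp add: path_sum_enat exp_ext_def exp_add ennreal_mult exp_sum prod_ennreal sum_distrib_left
            prod_nonneg del: sum.lessThan_Suc prod.lessThan_Suc)
    qed auto
    also have "\<dots> \<le> ennreal (S x)"
      by (rule suminf_weighted_step_le[OF _ _ _ step]) auto
    also have "S x \<le> exp (\<eta> * V x + ln s)"
    proof -
      have "z x powr (1 - \<eta>) \<le> s powr (1 - \<eta>)" using zs[of x] zp[of x] \<eta> by (intro powr_mono2) auto
      also have "\<dots> \<le> s powr 1" using s \<eta> by (intro powr_mono) auto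
      finally show ?thesis using s by (simp add: S_def exp_add)
    qed
    finally show "(\<integral>\<^sup>+\<omega>. exp_ext (ereal \<epsilon> * path_sum H (return_time A \<omega>) \<omega>
        + ereal (\<eta> * V (\<omega> (the_enat (return_time A \<omega>))))) \<partial>path_law P x) \<le> ennreal (exp (\<eta> * V x + ln s))"
      by (simp add: ennreal_leI)
  qed
qed

end

section \<open>Drift from exponential moments\<close>

lemma path_sum_nonneg:
  assumes "\<And>x. 1 \<le> H x" shows "0 \<le> path_sum H n \<omega>"
  using path_sum_ge[of H 0 n \<omega>] assms by (simp add: zero_enat_def[symmetric] zero_ereal_def[symmetric])

lemma exp_moment_mono:
  assumes "\<eta> \<le> \<eta>'" "\<And>x. 1 \<le> H x"
  shows "exp_moment P H A \<eta> x \<le> exp_moment P H A \<eta>' x"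
  unfolding exp_moment_def using assms
  by (intro nn_integral_mono exp_ext_mono ereal_mult_right_mono) (auto intro: path_sum_nonneg)

lemma L_infty_self:
  assumes "H \<in> borel_measurable borel" "\<And>x. 1 \<le> H x"
  shows "H \<in> L_infty H"
proof -
  have "\<bar>H x\<bar> / H x = 1" for x
    using assms(2)[of x] by simp
  then show ?thesis using assms(1) by (simp add: L_infty_def)
qed

context markov_kernel
begin

lemma survival_tendsto_0_of_exp_moment:
  assumes "A \<in> sets borel" "\<And>x. H x \<ge> 1" "\<eta> > 0" "exp_moment P H A \<eta> x < \<infinity>"
  shows "(\<lambda>n. survival A n x) \<longlonglongrightarrow> 0"
  using survival_tendsto_0_of_bound[OF survival_bound_exp_moment[OF assms(1-3)] assms(4,3)] .

lemma one_le_exp_moment: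
  assumes "A \<in> sets borel" "\<And>x. H x \<ge> 1" "\<eta> > 0"
  shows "1 \<le> exp_moment P H A \<eta> x"
  using survival_bound_exp_moment[OF assms, of 0 x] by simp

lemma exp_moment_eq_suminf:
  assumes A [measurable]: "A \<in> sets borel" and H [measurable]: "H \<in> borel_measurable borel"
    and H1: "\<And>x. H x \<ge> 1" and "\<eta> > 0" "exp_moment P H A \<eta> x < \<infinity>"
  defines "a \<equiv> \<lambda>x. ennreal (exp (\<eta> * H x))"
  shows "exp_moment P H A \<eta> x = (\<Sum>n. (weighted_step P a (- A) ^^ n) (weighted_step P a A (\<lambda>_. 1)) x)"
  unfolding exp_moment_def
proof (rule nn_integral_return_time[OF _ A])
  show "(\<lambda>n. survival A n x) \<longlonglongrightarrow> 0"
    by (rule survival_tendsto_0_of_exp_moment[OF A H1 assms(4,5)])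
  show "a \<in> borel_measurable borel" unfolding a_def by measurable
  fix \<omega> n assume "return_time A \<omega> = enat (Suc n)"
  then show "exp_ext (ereal \<eta> * path_sum H (return_time A \<omega>) \<omega>) = (\<Prod>t<Suc n. a (\<omega> t)) * 1"
    unfolding a_def
    by (simp add: path_sum_enat exp_ext_def exp_sum prod_ennreal sum_distrib_left
        prod_nonneg del: sum.lessThan_Suc prod.lessThan_Suc)
qed simp

lemma
  assumes A [measurable]: "A \<in> sets borel" and H [measurable]: "H \<in> borel_measurable borel"
    and H1: "\<And>x. H x \<ge> 1" and "\<eta> > 0" and fin: "\<And>x. exp_moment P H A \<eta> x < \<infinity>"
  shows exp_moment_measurable: "exp_moment P H A \<eta> \<in> borel_measurable borel" (is ?meas)
    and exp_moment_first_step: "exp_moment P H A \<eta> x =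
      ennreal (exp (\<eta> * H x)) * (\<integral>\<^sup>+y. (if y \<in> A then 1 else exp_moment P H A \<eta> y) \<partial>P x)" (is ?step)
proof -
  let ?a = "\<lambda>x. ennreal (exp (\<eta> * H x))"
  let ?g = "\<lambda>n. (weighted_step P ?a (- A) ^^ n) (weighted_step P ?a A (\<lambda>_. 1))"
  have eq: "exp_moment P H A \<eta> = (\<lambda>x. \<Sum>n. ?g n x)"
    by (rule ext) (rule exp_moment_eq_suminf[OF A H H1 \<open>\<eta> > 0\<close> fin])
  have g [measurable]: "?g n \<in> borel_measurable borel" for n
    by (rule weighted_step_iterate_measurable) measurable
  show m: ?meas
    unfolding eq by measurable
  have "exp_moment P H A \<eta> x = (\<Sum>n. ?g (Suc n) x) + ?g 0 x"
    unfolding eq using suminf_offset[of "\<lambda>n. ?g n x" 1] by simp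
  also have "(\<Sum>n. ?g (Suc n) x) = weighted_step P ?a (- A) (exp_moment P H A \<eta>) x"
    unfolding eq by (subst weighted_step_suminf) (use g in auto)
  also have "weighted_step P ?a (- A) (exp_moment P H A \<eta>) x + ?g 0 x =
      weighted_step P ?a A (\<lambda>_. 1) x + weighted_step P ?a (- A) (exp_moment P H A \<eta>) x"
    by (simp add: add.commute)
  also have "\<dots> = ?a x * (\<integral>\<^sup>+y. (if y \<in> A then 1 else exp_moment P H A \<eta> y) \<partial>P x)"
    by (rule weighted_step_partition[OF A _ m]) simp
  finally show ?step .
qed

text \<open>
  The function \<open>e\<^sup>V\<close> is a multiple of the moment \<open>G\<close> off \<open>C\<close> and constant on \<open>C\<close>, so the first-step equation
  reads \<open>P e\<^sup>V = e \<cdot> e\<^bsup>-\<eta>H\<^esup> G\<close>. Off \<open>C\<close> this is the drift inequality with equality; on \<open>C\<close> the bound on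
  \<open>G\<close> becomes the constant \<open>b\<close>. The summand \<open>1\<close> in \<open>V\<close> makes \<open>V\<close> positive.
\<close>

lemma exp_moment_imp_DV3:
  assumes C: "small_set P C" and H [measurable]: "H \<in> borel_measurable borel"
    and H1: "\<And>x. H x \<ge> 1" and \<eta>: "\<eta> > 0" and fin: "\<And>x. exp_moment P H C \<eta> x < \<infinity>"
    and K: "\<And>x. x \<in> C \<Longrightarrow> exp_moment P H C \<eta> x \<le> ennreal K"
  shows "\<exists>V. DV3 P V H"
proof -
  have C_meas [measurable]: "C \<in> sets borel" using C by (simp add: small_set_def)
  define G where "G x = enn2real (exp_moment P H C \<eta> x)" for x
  have G: "exp_moment P H C \<eta> x = ennreal (G x)" for x
    using fin[of x] by (simp add: G_def)
  have G1: "1 \<le> G x" for x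
    using one_le_exp_moment[where H = H and x = x, OF C_meas H1 \<eta>] unfolding G
    by (subst (asm) ennreal_1[symmetric], subst (asm) ennreal_le_iff) (auto simp: G_def)
  have [measurable]: "G \<in> borel_measurable borel"
    unfolding G_def[abs_def] using exp_moment_measurable[OF C_meas H H1 \<eta> fin] by measurable
  define V where "V x = 1 + (if x \<in> C then 0 else ln (G x))" for x
  have [measurable]: "V \<in> borel_measurable borel"
    unfolding V_def[abs_def] by measurable
  have Vpos: "V x > 0" for x
    using ln_ge_zero[OF G1[of x]] by (simp add: V_def)
  have PV: "(\<integral>\<^sup>+y. ennreal (exp (V y)) \<partial>P x) = ennreal (exp (1 - \<eta> * H x) * G x)" for x
  proof -
    have "ennreal (exp (V y)) = ennreal (exp 1) * (if y \<in> C then 1 else exp_moment P H C \<eta> y)" for y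
      using G1[of y] unfolding G by (auto simp: V_def exp_add ennreal_mult[symmetric])
    then have "(\<integral>\<^sup>+y. ennreal (exp (V y)) \<partial>P x) = ennreal (exp 1) * (\<integral>\<^sup>+y. (if y \<in> C then 1 else exp_moment P H C \<eta> y) \<partial>P x)" (is "_ = _ * ?I")
      using exp_moment_measurable[OF C_meas H H1 \<eta> fin] by (simp add: nn_integral_cmult)
    also have "?I = ennreal (exp (- \<eta> * H x)) * (ennreal (exp (\<eta> * H x)) * ?I)"
      unfolding mult.assoc[symmetric] by (simp add: ennreal_mult[symmetric] exp_add[symmetric])
    also have "ennreal (exp (\<eta> * H x)) * ?I = ennreal (G x)"
      unfolding exp_moment_first_step[OF C_meas H H1 \<eta> fin, symmetric] by (rule G)
    also have "ennreal (exp 1) * (ennreal (exp (- \<eta> * H x)) * ennreal (G x)) =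
        ennreal (exp 1 * (exp (- \<eta> * H x) * G x))"
      using G1[of x] by (simp add: ennreal_mult)
    also have "exp 1 * (exp (- \<eta> * H x) * G x) = exp (1 - \<eta> * H x) * G x"
      by (simp add: exp_diff exp_minus field_simps)
    finally show ?thesis .
  qed
  have drift: "nonlinear_generator P V x \<le> ereal (- \<eta> * H x + ln (max 1 K) * indicator C x)" for x
  proof -
    have "exp (1 - \<eta> * H x) * G x \<le> exp (V x + (- \<eta> * H x + ln (max 1 K) * indicator C x))"
    proof (cases "x \<in> C")
      case True
      have "ennreal (G x) \<le> ennreal (max 1 K)"
        using K[OF True] unfolding G by (rule order_trans) (simp add: ennreal_leI)
      then have "G x \<le> max 1 K"
        by (subst (asm) ennreal_le_iff) auto
      then have "exp (1 - \<eta> * H x) * G x \<le> exp (1 - \<eta> * H x) * exp (ln (max 1 K))"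
        by (intro mult_left_mono) auto
      moreover have "V x + (- \<eta> * H x + ln (max 1 K) * indicator C x) = (1 - \<eta> * H x) + ln (max 1 K)"
        using True by (simp add: V_def)
      ultimately show ?thesis
        by (simp only: exp_add)
    next
      case False
      have "exp (1 - \<eta> * H x) * G x = exp (1 - \<eta> * H x) * exp (ln (G x))"
        using G1[of x] by simp
      then show ?thesis
        using False by (simp add: V_def exp_add[symmetric] algebra_simps del: exp_ln)
    qed
    then show ?thesis
      unfolding nonlinear_generator_le_iff PV by (rule ennreal_leI)
  qed
  have "\<exists>C \<delta> b. small_set P C \<and> \<delta> > 0 \<and> (\<forall>x. nonlinear_generator P V x \<le> ereal (- \<delta> * H x + b * indicator C x))"
    using C \<eta> drift by blast
  then have "DV3 P V H"
    using Vpos H1 by (simp add: DV3_def)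
  then show ?thesis by blast
qed

text \<open>
  The uniform exponential moment bounds the tail of the return time uniformly on \<open>C\<close>. If survival up to
  time \<open>N\<close> has probability at most \<open>1/2\<close>, one of the \<open>N\<close> times carries at least an \<open>N\<close>-th part of
  the rest.
\<close>

lemma exp_moment_bounded_reaches:
  assumes A: "A \<in> sets borel" and H1: "\<And>x. H x \<ge> 1" and \<eta>: "\<eta> > 0"
    and bdd: "(SUP x\<in>C. exp_moment P H A \<eta> x) < \<infinity>"
  obtains N c where "0 < c" "\<And>x. x \<in> C \<Longrightarrow> \<exists>t\<in>{1..N}. ennreal c \<le> emeasure (kernel_pow P t x) A"
proof -
  obtain K where K: "0 \<le> K" "(SUP x\<in>C. exp_moment P H A \<eta> x) = ennreal K"
    using bdd by (cases "SUP x\<in>C. exp_moment P H A \<eta> x" rule: ennreal_cases) auto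
  \<comment> \<open>Then \<open>K / e\<^bsup>\<eta>N\<^esup> < 1/2\<close>, also if \<open>K = 0\<close>.\<close>
  obtain N :: nat where N: "2 * K + 1 < exp \<eta> ^ N"
    using real_arch_pow[of "exp \<eta>"] \<eta> by auto
  have "survival A N x \<le> ennreal (1/2)" if "x \<in> C" for x
  proof -
    have "survival A N x \<le> 1" using survival_antimono[of 0 N A x] by simp
    then obtain s where s: "survival A N x = ennreal s" "0 \<le> s"
      by (cases "survival A N x" rule: ennreal_cases) (auto simp: top_unique)
    have "exp (\<eta> * real N) = exp \<eta> ^ N"
      by (simp add: exp_of_nat_mult[symmetric] mult.commute)
    moreover have "ennreal (exp (\<eta> * real N)) * survival A N x \<le> ennreal K"
      using survival_bound_exp_moment[where H = H and n = N and x = x, OF A H1 \<eta>] SUP_upper[OF that, of "exp_moment P H A \<eta>"]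
      unfolding K(2) by (rule order_trans)
    ultimately have "ennreal (exp \<eta> ^ N * s) \<le> ennreal K"
      using s by (simp add: ennreal_mult)
    then have "exp \<eta> ^ N * s \<le> K"
      using K(1) by (subst (asm) ennreal_le_iff) auto
    moreover have "(2 * K + 1) * s \<le> exp \<eta> ^ N * s"
      using N s(2) by (intro mult_right_mono) auto
    ultimately have "(2 * K + 1) * s \<le> K" by simp
    moreover have "K \<le> (2 * K + 1) * (1/2)" by (simp add: field_simps)
    ultimately have "(2 * K + 1) * s \<le> (2 * K + 1) * (1/2)" by (rule order_trans)
    then have "s \<le> 1/2"
      using K(1) by (subst (asm) mult_le_cancel_left_pos) auto
    then show ?thesis unfolding s(1) by (rule ennreal_leI)
  qed
  note half = this
  show thesis
  proof (rule that)
    show "0 < 1 / (2 * (real N + 1))" by simp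
    fix x assume "x \<in> C"
    show "\<exists>t\<in>{1..N}. ennreal (1 / (2 * (real N + 1))) \<le> emeasure (kernel_pow P t x) A"
    proof (rule ccontr)
      assume neg: "\<not> ?thesis"
      have "1 \<le> survival A N x + (\<Sum>t=1..N. emeasure (kernel_pow P t x) A)"
        by (rule one_le_survival_add_hits[OF A])
      also have "\<dots> \<le> ennreal (1/2) + (\<Sum>t=1..N. ennreal (1 / (2 * (real N + 1))))"
        using neg by (intro add_mono half \<open>x \<in> C\<close> sum_mono) (auto simp: not_le dest: less_imp_le)
      also have "(\<Sum>t=1..N. ennreal (1 / (2 * (real N + 1)))) = ennreal (real N / (2 * (real N + 1)))"
        by (subst sum_ennreal) auto
      also have "ennreal (1/2) + \<dots> = ennreal (1/2 + real N / (2 * (real N + 1)))"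
        by (rule ennreal_plus[symmetric]) auto
      finally have "1 \<le> 1/2 + real N / (2 * (real N + 1))"
        by (subst (asm) ennreal_1[symmetric], subst (asm) ennreal_le_iff) auto
      then show False by (simp add: field_simps)
    qed
  qed
qed

end

section \<open>Kernels with a dominated reference measure\<close>

text \<open>
  Two finite measures that agree on such a generator are equal; countability lets one exceptional null
  set serve all its members.
\<close>

lemma countable_Int_stable_generator_borel:
  obtains G :: "'a::second_countable_topology set set"
  where "countable G" "Int_stable G" "UNIV \<in> G" "sets borel = sigma_sets UNIV G"
proof -
  obtain B :: "'a set set" where B: "countable B" "topological_basis B"
    using ex_countable_basis by blast
  define G where "G = Inter ` {F. finite F \<and> F \<subseteq> B}"
  have open_G: "open X" if "X \<in> G" for X
    using that topological_basis_open[OF B(2)] by (auto simp: G_def intro!: open_Inter)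
  have "sets borel = sigma_sets UNIV B"
    unfolding borel_eq_countable_basis[OF B] by (rule sets_measure_of) simp
  also have "B \<subseteq> G"
    by (auto simp: G_def intro!: image_eqI[of _ _ "{_}"])
  then have "sigma_sets UNIV B \<subseteq> sigma_sets UNIV G"
    by (rule sigma_sets_subseteq)
  finally have "sets borel \<subseteq> sigma_sets UNIV G" .
  moreover have "sigma_sets UNIV G \<subseteq> sets borel"
    using open_G by (intro sets.sigma_sets_subset[of G borel, simplified]) auto
  ultimately have eq: "sets borel = sigma_sets UNIV G" by blast
  show thesis
  proof (rule that[OF _ _ _ eq])
    show "countable G"
      unfolding G_def using countable_Collect_finite_subset[OF B(1)] by simp
    show "Int_stable G"
    proof (rule Int_stableI)
      fix a b assume "a \<in> G" "b \<in> G"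
      then obtain F F' where "finite F" "F \<subseteq> B" "a = \<Inter>F" "finite F'" "F' \<subseteq> B" "b = \<Inter>F'"
        by (auto simp: G_def)
      then show "a \<inter> b \<in> G"
        by (auto simp: G_def intro!: image_eqI[of _ _ "F \<union> F'"])
    qed
    show "UNIV \<in> G"
      by (auto simp: G_def intro!: image_eqI[of _ _ "{}"])
  qed
qed

text \<open>
  Radon-Nikodym derivatives of \<open>\<mu>\<close> with respect to the single measures \<open>K x\<close> need not be jointly
  measurable. Instead the derivative is taken once, of the product measure with respect to
  the measure \<open>\<mu>(dx) K x (dy)\<close>; domination holds slice by slice, hence also for the products. Testing on
  products of sets disintegrates the density again.
\<close>

lemma kernel_density:
  fixes \<mu> :: "'a::polish_space measure" and K :: "'a \<Rightarrow> 'a measure"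
  assumes K: "K \<in> borel \<rightarrow>\<^sub>M prob_algebra borel"
    and \<mu>: "prob_space \<mu>" and sets_\<mu> [measurable_cong]: "sets \<mu> = sets borel"
    and ac: "\<And>x A. A \<in> sets borel \<Longrightarrow> emeasure (K x) A = 0 \<Longrightarrow> emeasure \<mu> A = 0"
  obtains h where "h \<in> borel_measurable (borel \<Otimes>\<^sub>M borel)"
    "AE x in \<mu>. \<mu> = density (K x) (\<lambda>y. h (x, y))"
    "AE p in \<mu> \<Otimes>\<^sub>M \<mu>. h p \<noteq> \<infinity>"
proof -
  interpret \<mu>: prob_space \<mu> by (rule \<mu>)
  interpret \<mu>\<mu>: pair_prob_space \<mu> \<mu> by standard
  have K_sub [measurable]: "K \<in> borel \<rightarrow>\<^sub>M subprob_algebra borel"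
    using K by (rule measurable_prob_algebraD)
  have sets_K [simp, measurable_cong]: "sets (K x) = sets borel" for x
    using measurable_space[OF K, of x] by (simp add: space_prob_algebra)
  have K_prob: "prob_space (K x)" for x
    using measurable_space[OF K, of x] by (simp add: space_prob_algebra)
  have space_\<mu>: "space \<mu> = UNIV"
    using sets_eq_imp_space_eq[OF sets_\<mu>] by simp
  let ?B2 = "borel \<Otimes>\<^sub>M borel :: ('a \<times> 'a) measure"
  define \<kappa> where "\<kappa> x = distr (K x) ?B2 (\<lambda>y. (x, y))" for x
  have \<kappa>: "\<kappa> \<in> \<mu> \<rightarrow>\<^sub>M subprob_algebra ?B2"
    unfolding \<kappa>_def[abs_def] measurable_cong_sets[OF sets_\<mu> refl]
    by (rule measurable_distr2[OF _ K_sub]) simp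
  define \<Lambda> where "\<Lambda> = \<mu> \<bind> \<kappa>"
  have sets_\<Lambda> [measurable_cong]: "sets \<Lambda> = sets ?B2"
    unfolding \<Lambda>_def by (rule sets_bind[OF sets_kernel[OF \<kappa>]]) (auto simp: space_\<mu>)
  have int_\<Lambda>: "(\<integral>\<^sup>+p. F p \<partial>\<Lambda>) = (\<integral>\<^sup>+x. \<integral>\<^sup>+y. F (x, y) \<partial>K x \<partial>\<mu>)" if [measurable]: "F \<in> borel_measurable ?B2" for F
    unfolding \<Lambda>_def
    by (subst nn_integral_bind[OF that \<kappa>]) (simp add: \<kappa>_def nn_integral_distr)
  have "prob_space \<Lambda>"
  proof
    have "emeasure \<Lambda> (space \<Lambda>) = (\<integral>\<^sup>+p. 1 \<partial>\<Lambda>)" by simp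
    also have "\<dots> = 1"
      using prob_space.emeasure_space_1[OF K_prob] \<mu>.emeasure_space_1 by (subst int_\<Lambda>) simp_all
    finally show "emeasure \<Lambda> (space \<Lambda>) = 1" .
  qed
  then interpret \<Lambda>: prob_space \<Lambda> .
  have sets_\<mu>\<mu> [measurable_cong]: "sets (\<mu> \<Otimes>\<^sub>M \<mu>) = sets ?B2"
    by (rule sets_pair_measure_cong) (auto simp: sets_\<mu>)
  have ac2: "absolutely_continuous \<Lambda> (\<mu> \<Otimes>\<^sub>M \<mu>)"
    unfolding absolutely_continuous_def
  proof
    fix S assume S: "S \<in> null_sets \<Lambda>"
    then have [measurable]: "S \<in> sets ?B2" by (auto simp: sets_\<Lambda>)
    have slice [measurable]: "Pair x -` S \<in> sets borel" for x
      by (rule sets_Pair1) measurable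
    have "0 = (\<integral>\<^sup>+p. indicator S p \<partial>\<Lambda>)" using S by (auto simp: sets_\<Lambda>)
    also have "\<dots> = (\<integral>\<^sup>+x. \<integral>\<^sup>+y. indicator S (x, y) \<partial>K x \<partial>\<mu>)" by (rule int_\<Lambda>) simp
    finally have "(\<integral>\<^sup>+x. \<integral>\<^sup>+y. indicator S (x, y) \<partial>K x \<partial>\<mu>) = 0" ..
    moreover have "(\<lambda>x. \<integral>\<^sup>+y. indicator S (x, y) \<partial>K x) \<in> borel_measurable \<mu>"
      unfolding measurable_cong_sets[OF sets_\<mu> refl]
      by (rule nn_integral_measurable_subprob_algebra2[OF _ K_sub]) measurable
    ultimately have "AE x in \<mu>. (\<integral>\<^sup>+y. indicator S (x, y) \<partial>K x) = 0"
      by (simp only: nn_integral_0_iff_AE)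
    then have "AE x in \<mu>. emeasure \<mu> (Pair x -` S) = 0"
    proof eventually_elim
      fix x assume "(\<integral>\<^sup>+y. indicator S (x, y) \<partial>K x) = 0"
      moreover have "(\<integral>\<^sup>+y. indicator S (x, y) \<partial>K x) = (\<integral>\<^sup>+y. indicator (Pair x -` S) y \<partial>K x)"
        by (rule nn_integral_cong) (simp add: indicator_def)
      ultimately have "emeasure (K x) (Pair x -` S) = 0" by simp
      then show "emeasure \<mu> (Pair x -` S) = 0" by (rule ac[OF slice])
    qed
    then have "(\<integral>\<^sup>+x. emeasure \<mu> (Pair x -` S) \<partial>\<mu>) = (\<integral>\<^sup>+x. 0 \<partial>\<mu>)"
      by (rule nn_integral_cong_AE)
    then have "emeasure (\<mu> \<Otimes>\<^sub>M \<mu>) S = 0"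
      by (subst \<mu>.emeasure_pair_measure_alt) (auto simp: sets_\<mu>\<mu>)
    then show "S \<in> null_sets (\<mu> \<Otimes>\<^sub>M \<mu>)"
      by (auto simp: sets_\<mu>\<mu>)
  qed
  define h where "h = RN_deriv \<Lambda> (\<mu> \<Otimes>\<^sub>M \<mu>)"
  have h [measurable]: "h \<in> borel_measurable ?B2"
    unfolding h_def using borel_measurable_RN_deriv[of \<Lambda>] by (simp add: measurable_cong_sets[OF sets_\<Lambda> refl])
  have dens: "density \<Lambda> h = \<mu> \<Otimes>\<^sub>M \<mu>"
    unfolding h_def by (rule \<Lambda>.density_RN_deriv[OF ac2]) (simp add: sets_\<mu>\<mu> sets_\<Lambda>)
  have slice_eq: "AE x in \<mu>. emeasure \<mu> A = (\<integral>\<^sup>+y. h (x, y) * indicator A y \<partial>K x)" if A [measurable]: "A \<in> sets borel" for A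
  proof (rule \<mu>.density_unique)
    have gm: "(\<lambda>x. \<integral>\<^sup>+y. h (x, y) * indicator A y \<partial>K x) \<in> borel_measurable borel"
      by (rule nn_integral_measurable_subprob_algebra2[OF _ K_sub]) measurable
    then show gm': "(\<lambda>x. \<integral>\<^sup>+y. h (x, y) * indicator A y \<partial>K x) \<in> borel_measurable \<mu>"
      unfolding measurable_cong_sets[OF sets_\<mu> refl] .
    show "density \<mu> (\<lambda>_. emeasure \<mu> A) = density \<mu> (\<lambda>x. \<integral>\<^sup>+y. h (x, y) * indicator A y \<partial>K x)"
    proof (rule measure_eqI)
      fix A1 assume "A1 \<in> sets (density \<mu> (\<lambda>_. emeasure \<mu> A))"
      then have A1 [measurable]: "A1 \<in> sets borel" by (simp add: sets_\<mu>)
      have "emeasure (density \<mu> (\<lambda>_. emeasure \<mu> A)) A1 = emeasure \<mu> A1 * emeasure \<mu> A"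
        by (simp add: emeasure_density nn_integral_multc sets_\<mu> mult.commute)
      also have "\<dots> = emeasure (\<mu> \<Otimes>\<^sub>M \<mu>) (A1 \<times> A)"
        by (rule \<mu>.emeasure_pair_measure_Times[symmetric]) (auto simp: sets_\<mu>)
      also have "\<dots> = (\<integral>\<^sup>+p. h p * indicator (A1 \<times> A) p \<partial>\<Lambda>)"
        unfolding dens[symmetric] by (rule emeasure_density) measurable
      also have "\<dots> = (\<integral>\<^sup>+x. \<integral>\<^sup>+y. h (x, y) * indicator (A1 \<times> A) (x, y) \<partial>K x \<partial>\<mu>)"
        by (rule int_\<Lambda>) measurable
      also have "\<dots> = (\<integral>\<^sup>+x. (\<integral>\<^sup>+y. h (x, y) * indicator A y \<partial>K x) * indicator A1 x \<partial>\<mu>)"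
        by (rule nn_integral_cong) (auto simp: indicator_times split: split_indicator)
      also have "\<dots> = emeasure (density \<mu> (\<lambda>x. \<integral>\<^sup>+y. h (x, y) * indicator A y \<partial>K x)) A1"
        by (rule emeasure_density[OF gm', symmetric]) (simp add: sets_\<mu>)
      finally show "emeasure (density \<mu> (\<lambda>_. emeasure \<mu> A)) A1 = \<dots>" .
    qed simp
  qed measurable
  obtain G :: "'a set set" where G: "countable G" "Int_stable G" "UNIV \<in> G" "sets borel = sigma_sets UNIV G"
    by (rule countable_Int_stable_generator_borel)
  have "AE x in \<mu>. \<forall>A\<in>G. emeasure \<mu> A = (\<integral>\<^sup>+y. h (x, y) * indicator A y \<partial>K x)"
    using G by (intro AE_ball_countable' slice_eq) auto
  then have "AE x in \<mu>. \<mu> = density (K x) (\<lambda>y. h (x, y))"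
  proof eventually_elim
    fix x assume eq: "\<forall>A\<in>G. emeasure \<mu> A = (\<integral>\<^sup>+y. h (x, y) * indicator A y \<partial>K x)"
    show "\<mu> = density (K x) (\<lambda>y. h (x, y))"
    proof (rule measure_eqI_generator_eq[OF G(2), where A = "\<lambda>_. UNIV"])
      fix X assume "X \<in> G"
      then have [measurable]: "X \<in> sets borel" using G by auto
      show "emeasure \<mu> X = emeasure (density (K x) (\<lambda>y. h (x, y))) X"
        using eq \<open>X \<in> G\<close> by (simp add: emeasure_density)
    next
      show "emeasure \<mu> UNIV \<noteq> \<infinity>" by simp
    qed (use G in \<open>auto simp: sets_\<mu>\<close>)
  qed
  moreover have "AE p in \<mu> \<Otimes>\<^sub>M \<mu>. h p \<noteq> \<infinity>"
  proof -
    have "(\<integral>\<^sup>+p. h p \<partial>\<Lambda>) = emeasure (density \<Lambda> h) (space \<Lambda>)"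
      by (subst emeasure_density) (auto intro!: nn_integral_cong)
    also have "\<dots> = 1"
      using \<mu>\<mu>.emeasure_space_1 dens by (metis space_density)
    finally have "AE p in \<Lambda>. h p \<noteq> \<infinity>"
      by (intro nn_integral_noteq_infinite) auto
    then show ?thesis
      using absolutely_continuous_AE[OF _ ac2] by (simp add: sets_\<mu>\<mu> sets_\<Lambda>)
  qed
  ultimately show thesis using that h by blast
qed

text \<open>
  Let \<open>T\<close> be the set where the density \<open>h\<close> of \<open>\<mu>\<close> exceeds \<open>n\<close>; off \<open>T\<close> the kernel is at least \<open>\<mu> / n\<close>. For
  large \<open>n\<close> the set \<open>T\<close> has small product measure, so for \<open>x\<close> in a positive set \<open>D\<close> and \<open>z\<close> in a
  positive set \<open>E\<close>, at most a quarter of the intermediate points \<open>y\<close> has \<open>(x, y) \<in> T\<close> and at most a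
  quarter has \<open>(y, z) \<in> T\<close>. The other half of the points connects \<open>x\<close> to \<open>z\<close> with density at least
  \<open>1 / n\<^sup>2\<close>. The minorizing measure is \<open>\<mu>\<close> conditioned on \<open>E\<close>.
\<close>

lemma kernel_square_minorized:
  fixes \<mu> :: "'a::polish_space measure" and K :: "'a \<Rightarrow> 'a measure"
  assumes K: "K \<in> borel \<rightarrow>\<^sub>M prob_algebra borel"
    and \<mu>: "prob_space \<mu>" and sets_\<mu> [measurable_cong]: "sets \<mu> = sets borel"
    and ac: "\<And>x A. A \<in> sets borel \<Longrightarrow> emeasure (K x) A = 0 \<Longrightarrow> emeasure \<mu> A = 0"
  obtains D and \<nu> :: "'a measure" and c :: real where "D \<in> sets borel" "emeasure \<mu> D > 0" "prob_space \<nu>" "sets \<nu> = sets borel" "0 < c"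
    "\<And>x A. x \<in> D \<Longrightarrow> A \<in> sets borel \<Longrightarrow> ennreal c * emeasure \<nu> A \<le> (\<integral>\<^sup>+y. emeasure (K y) A \<partial>K x)"
proof -
  interpret \<mu>: prob_space \<mu> by (rule \<mu>)
  interpret \<mu>\<mu>: pair_prob_space \<mu> \<mu> by standard
  have K_sub [measurable]: "K \<in> borel \<rightarrow>\<^sub>M subprob_algebra borel"
    using K by (rule measurable_prob_algebraD)
  have sets_K [simp, measurable_cong]: "sets (K x) = sets borel" for x
    using measurable_space[OF K, of x] by (simp add: space_prob_algebra)
  have space_\<mu>: "space \<mu> = UNIV"
    using sets_eq_imp_space_eq[OF sets_\<mu>] by simp
  let ?B2 = "borel \<Otimes>\<^sub>M borel :: ('a \<times> 'a) measure"
  have sets_\<mu>\<mu> [measurable_cong]: "sets (\<mu> \<Otimes>\<^sub>M \<mu>) = sets ?B2"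
    by (rule sets_pair_measure_cong) (auto simp: sets_\<mu>)
  obtain h where h [measurable]: "h \<in> borel_measurable ?B2"
    and dens: "AE x in \<mu>. \<mu> = density (K x) (\<lambda>y. h (x, y))"
    and fin: "AE p in \<mu> \<Otimes>\<^sub>M \<mu>. h p \<noteq> \<infinity>"
    by (rule kernel_density[OF K \<mu> sets_\<mu> ac])
  obtain N where N: "N \<in> null_sets \<mu>" and N_dens: "\<And>x. x \<notin> N \<Longrightarrow> \<mu> = density (K x) (\<lambda>y. h (x, y))"
    using AE_E3[OF dens] by (auto simp: space_\<mu>)
  have [measurable]: "N \<in> sets borel" using N by (auto simp: sets_\<mu>)
  define T where "T n = {p. of_nat n < h p}" for n :: nat
  have T_meas [measurable]: "T n \<in> sets ?B2" for n
  proof -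
    have "{p \<in> space ?B2. of_nat n < h p} \<in> sets ?B2" by measurable
    then show ?thesis by (simp add: T_def space_pair_measure)
  qed
  have "(\<lambda>n. emeasure (\<mu> \<Otimes>\<^sub>M \<mu>) (T n)) \<longlonglongrightarrow> emeasure (\<mu> \<Otimes>\<^sub>M \<mu>) (\<Inter>n. T n)"
  proof (rule Lim_emeasure_decseq)
    show "range T \<subseteq> sets (\<mu> \<Otimes>\<^sub>M \<mu>)" by (auto simp: sets_\<mu>\<mu>)
    show "decseq T" by (auto simp: decseq_def T_def intro: le_less_trans[rotated])
  qed simp
  moreover have "emeasure (\<mu> \<Otimes>\<^sub>M \<mu>) (\<Inter>n. T n) = 0"
  proof -
    have "AE p in \<mu> \<Otimes>\<^sub>M \<mu>. p \<notin> (\<Inter>n. T n)"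
      using fin
    proof eventually_elim
      fix p assume "h p \<noteq> \<infinity>"
      then obtain n :: nat where "h p < of_nat n"
        using ennreal_Ex_less_of_nat by (auto simp: less_top)
      then show "p \<notin> (\<Inter>n. T n)" by (auto simp: T_def intro!: exI[of _ n])
    qed
    then show ?thesis
      by (subst (asm) AE_iff_measurable[of "\<Inter>n. T n"]) (auto simp: sets_\<mu>\<mu> space_pair_measure space_\<mu>)
  qed
  moreover have "(0 :: ennreal) < 1/4"
    by (simp add: ennreal_zero_less_divide)
  ultimately have "\<forall>\<^sub>F n in sequentially. emeasure (\<mu> \<Otimes>\<^sub>M \<mu>) (T n) < 1/4"
    by (simp add: order_tendstoD(2))
  then have "\<forall>\<^sub>F n in sequentially. emeasure (\<mu> \<Otimes>\<^sub>M \<mu>) (T n) < 1/4 \<and> 0 < n"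
    using eventually_gt_at_top[of "0::nat"] by (rule eventually_conj)
  then obtain n :: nat where n: "emeasure (\<mu> \<Otimes>\<^sub>M \<mu>) (T n) < 1/4" "0 < n"
    by (auto simp: eventually_sequentially)
  define u where "u x = emeasure \<mu> (Pair x -` T n)" for x
  define v where "v z = emeasure \<mu> ((\<lambda>y. (y, z)) -` T n)" for z
  have u_meas [measurable]: "u \<in> borel_measurable borel"
    using \<mu>.measurable_emeasure_Pair[of "T n" \<mu>] unfolding u_def[abs_def]
    by (simp add: sets_\<mu>\<mu> measurable_cong_sets[OF sets_\<mu> refl])
  have v_meas [measurable]: "v \<in> borel_measurable borel"
    using \<mu>\<mu>.measurable_emeasure_Pair2[of "T n"] unfolding v_def[abs_def]
    by (simp add: sets_\<mu>\<mu> measurable_cong_sets[OF sets_\<mu> refl])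
  \<comment> \<open>Markov's inequality, used for the mass of the slices of \<open>T\<close> in both directions.\<close>
  have small_pos: "emeasure \<mu> {x. w x \<le> 1/4} > 0"
    if [measurable]: "w \<in> borel_measurable borel" and "(\<integral>\<^sup>+x. w x \<partial>\<mu>) < 1/4" for w :: "'a \<Rightarrow> ennreal"
  proof (rule ccontr)
    assume "\<not> ?thesis"
    moreover have "{x \<in> space \<mu>. w x \<le> 1/4} \<in> sets \<mu>" by measurable
    ultimately have "{x. w x \<le> 1/4} \<in> null_sets \<mu>" by (auto simp: space_\<mu>)
    then have "AE x in \<mu>. 1/4 \<le> w x"
      by (rule eventually_mono[OF AE_not_in]) auto
    then have "(\<integral>\<^sup>+x. 1/4 \<partial>\<mu>) \<le> (\<integral>\<^sup>+x. w x \<partial>\<mu>)"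
      by (rule nn_integral_mono_AE)
    then show False
      using that(2) \<mu>.emeasure_space_1 by simp
  qed
  define E where "E = {z. v z \<le> 1/4}"
  have E [measurable]: "E \<in> sets borel"
    unfolding E_def by measurable
  have E_pos: "emeasure \<mu> E > 0"
    unfolding E_def
  proof (rule small_pos)
    show "(\<integral>\<^sup>+x. v x \<partial>\<mu>) < 1/4"
      using n \<mu>\<mu>.emeasure_pair_measure_alt2[of "T n"] by (simp add: v_def sets_\<mu>\<mu>)
  qed measurable
  define D where "D = {x. u x \<le> 1/4} - N"
  have D [measurable]: "D \<in> sets borel"
    unfolding D_def by measurable
  have D_pos: "emeasure \<mu> D > 0"
  proof -
    have "emeasure \<mu> D = emeasure \<mu> {x. u x \<le> 1/4}"
      unfolding D_def by (rule emeasure_Diff_null_set[OF N]) (simp add: sets_\<mu>)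
    moreover have "emeasure \<mu> {x. u x \<le> 1/4} > 0"
    proof (rule small_pos)
      show "(\<integral>\<^sup>+x. u x \<partial>\<mu>) < 1/4"
        using n \<mu>.emeasure_pair_measure_alt[of "T n" \<mu>] by (simp add: u_def sets_\<mu>\<mu>)
    qed measurable
    ultimately show ?thesis by simp
  qed
  have lower: "(\<integral>\<^sup>+y. \<phi> y * indicator (- T n) (x, y) \<partial>\<mu>) \<le> of_nat n * (\<integral>\<^sup>+y. \<phi> y \<partial>K x)"
    if "x \<notin> N" and [measurable]: "\<phi> \<in> borel_measurable borel" for x \<phi>
  proof -
    have "(\<integral>\<^sup>+y. \<phi> y * indicator (- T n) (x, y) \<partial>\<mu>) = (\<integral>\<^sup>+y. h (x, y) * (\<phi> y * indicator (- T n) (x, y)) \<partial>K x)"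
      by (subst N_dens[OF that(1)], rule nn_integral_density) measurable
    also have "\<dots> \<le> (\<integral>\<^sup>+y. of_nat n * \<phi> y \<partial>K x)"
      by (intro nn_integral_mono) (auto simp: T_def split: split_indicator intro!: mult_right_mono)
    finally show ?thesis by (simp add: nn_integral_cmult)
  qed
  have good: "1/2 \<le> (\<integral>\<^sup>+y. indicator (- T n) (x, y) * indicator (- T n) (y, z) \<partial>\<mu>)" if "x \<in> D" "z \<in> E" for x z
  proof -
    have "1 = (\<integral>\<^sup>+y. 1 \<partial>\<mu>)" using \<mu>.emeasure_space_1 by simp
    also have "\<dots> \<le> (\<integral>\<^sup>+y. indicator (- T n) (x, y) * indicator (- T n) (y, z) + (indicator (T n) (x, y) + indicator (T n) (y, z)) \<partial>\<mu>)"
      by (rule nn_integral_mono) (auto split: split_indicator)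
    also have "\<dots> = (\<integral>\<^sup>+y. indicator (- T n) (x, y) * indicator (- T n) (y, z) \<partial>\<mu>)
       + ((\<integral>\<^sup>+y. indicator (T n) (x, y) \<partial>\<mu>) + (\<integral>\<^sup>+y. indicator (T n) (y, z) \<partial>\<mu>))"
      by (simp add: nn_integral_add)
    also have "(\<integral>\<^sup>+y. indicator (T n) (x, y) \<partial>\<mu>) = (\<integral>\<^sup>+y. indicator (Pair x -` T n) y \<partial>\<mu>)"
      by (rule nn_integral_cong) (simp add: indicator_def)
    also have "\<dots> = u x"
      unfolding u_def by (rule nn_integral_indicator) (simp add: sets_\<mu> sets_Pair1[OF T_meas])
    also have "(\<integral>\<^sup>+y. indicator (T n) (y, z) \<partial>\<mu>) = (\<integral>\<^sup>+y. indicator ((\<lambda>y. (y, z)) -` T n) y \<partial>\<mu>)"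
      by (rule nn_integral_cong) (simp add: indicator_def)
    also have "\<dots> = v z"
      unfolding v_def by (rule nn_integral_indicator) (simp add: sets_\<mu> sets_Pair2[OF T_meas])
    also have "u x + v z \<le> 1/4 + 1/4"
      using that by (intro add_mono) (auto simp: D_def E_def)
    finally have *: "1 \<le> (\<integral>\<^sup>+y. indicator (- T n) (x, y) * indicator (- T n) (y, z) \<partial>\<mu>) + (1/4 + 1/4)" (is "1 \<le> ?I + _")
      by (simp add: add_left_mono)
    have fractions: "(1/4 :: ennreal) = ennreal (1/4)" "(1/2 :: ennreal) = ennreal (1/2)"
      using divide_ennreal[of 1 4] divide_ennreal[of 1 2]
      by (simp_all only: ennreal_1 ennreal_numeral zero_le_one zero_less_numeral simp_thms)
    have quarter: "(1/4 :: ennreal) + 1/4 = ennreal (1/2)"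
      unfolding fractions by (subst ennreal_plus[symmetric]) simp_all
    show ?thesis
    proof (cases ?I rule: ennreal_cases)
      case (real r)
      with * have "ennreal 1 \<le> ennreal (r + 1/2)"
        unfolding quarter by (simp only: ennreal_plus ennreal_1 zero_le_divide_1_iff zero_le_numeral)
      then have "1/2 \<le> r"
        using real(1) by (subst (asm) ennreal_le_iff) auto
      then show ?thesis
        unfolding real(2) fractions by (rule ennreal_leI)
    qed (simp only: top_greatest)
  qed
  define e where "e = measure \<mu> E"
  have e: "emeasure \<mu> E = ennreal e" "0 < e"
    using E_pos by (auto simp: e_def \<mu>.emeasure_eq_measure)
  define \<nu> where "\<nu> = uniform_measure \<mu> E"
  define c where "c = e / (2 * real n * real n)"
  show thesis
  proof (rule that[OF D D_pos])
    show "prob_space \<nu>"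
      unfolding \<nu>_def by (rule prob_space_uniform_measure) (use e in auto)
    show "sets \<nu> = sets borel" by (simp add: \<nu>_def sets_\<mu>)
    show "0 < c" using e n by (simp add: c_def)
    fix x and A :: "'a set" assume "x \<in> D" and A [measurable]: "A \<in> sets borel"
    then have "x \<notin> N" by (simp add: D_def)
    let ?J = "\<integral>\<^sup>+y. emeasure (K y) A \<partial>K x"
    have "1/2 * emeasure \<mu> (E \<inter> A) = (\<integral>\<^sup>+z. 1/2 * indicator (E \<inter> A) z \<partial>\<mu>)"
      by (rule nn_integral_cmult_indicator[symmetric]) (simp add: sets_\<mu>)
    also have "\<dots> \<le> (\<integral>\<^sup>+z. \<integral>\<^sup>+y. indicator (- T n) (x, y) * indicator (- T n) (y, z) * indicator A z \<partial>\<mu> \<partial>\<mu>)"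
      using good[OF \<open>x \<in> D\<close>] by (intro nn_integral_mono) (auto simp: nn_integral_multc split: split_indicator)
    also have "\<dots> = (\<integral>\<^sup>+y. \<integral>\<^sup>+z. indicator (- T n) (x, y) * indicator (- T n) (y, z) * indicator A z \<partial>\<mu> \<partial>\<mu>)"
      by (rule \<mu>\<mu>.Fubini') measurable
    also have "\<dots> \<le> (\<integral>\<^sup>+y. of_nat n * emeasure (K y) A * indicator (- T n) (x, y) \<partial>\<mu>)"
    proof (rule nn_integral_mono_AE)
      show "AE y in \<mu>. (\<integral>\<^sup>+z. indicator (- T n) (x, y) * indicator (- T n) (y, z) * indicator A z \<partial>\<mu>)
          \<le> of_nat n * emeasure (K y) A * indicator (- T n) (x, y)"
        using AE_not_in[OF N]
      proof eventually_elim
        fix y assume "y \<notin> N"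
        have "(\<integral>\<^sup>+z. indicator (- T n) (x, y) * indicator (- T n) (y, z) * indicator A z \<partial>\<mu>) =
            indicator (- T n) (x, y) * (\<integral>\<^sup>+z. indicator A z * indicator (- T n) (y, z) \<partial>\<mu>)"
          by (subst nn_integral_cmult[symmetric]) (auto simp: mult_ac)
        also have "\<dots> \<le> indicator (- T n) (x, y) * (of_nat n * (\<integral>\<^sup>+z. indicator A z \<partial>K y))"
          by (intro mult_left_mono lower \<open>y \<notin> N\<close>) auto
        finally show "(\<integral>\<^sup>+z. indicator (- T n) (x, y) * indicator (- T n) (y, z) * indicator A z \<partial>\<mu>)
          \<le> of_nat n * emeasure (K y) A * indicator (- T n) (x, y)"
          by (simp add: mult_ac)
      qed
    qed
    also have "\<dots> \<le> of_nat n * (\<integral>\<^sup>+y. of_nat n * emeasure (K y) A \<partial>K x)"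
      by (rule lower[OF \<open>x \<notin> N\<close>]) measurable
    also have "\<dots> = of_nat n * (of_nat n * ?J)"
      by (simp add: nn_integral_cmult)
    finally have main: "1/2 * emeasure \<mu> (E \<inter> A) \<le> of_nat n * (of_nat n * ?J)" .
    define r where "r = measure \<mu> (E \<inter> A)"
    have r: "emeasure \<mu> (E \<inter> A) = ennreal r" "0 \<le> r" by (auto simp: r_def \<mu>.emeasure_eq_measure)
    have \<nu>A: "emeasure \<nu> A = ennreal (r / e)"
      unfolding \<nu>_def using e r by (simp add: sets_\<mu> divide_ennreal)
    have "ennreal c * emeasure \<nu> A = ennreal (c * (r / e))"
      unfolding \<nu>A using e r by (intro ennreal_mult[symmetric]) (simp_all add: c_def)
    also have "c * (r / e) = (1 / (real n * real n)) * (1/2 * r)"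
      using e n by (simp add: c_def field_simps)
    also have "ennreal \<dots> = ennreal (1 / (real n * real n)) * (1/2 * emeasure \<mu> (E \<inter> A))"
    proof -
      have half: "(1/2 :: ennreal) = ennreal (1/2)"
        using divide_ennreal[of 1 2] by (simp only: ennreal_1 ennreal_numeral zero_le_one zero_less_numeral simp_thms)
      show ?thesis
        unfolding r(1) half ennreal_mult[OF order_less_imp_le[OF half_gt_zero[OF zero_less_one]] r(2), symmetric]
        using r(2) by (intro ennreal_mult) auto
    qed
    also have "\<dots> \<le> ennreal (1 / (real n * real n)) * (of_nat n * (of_nat n * ?J))"
      by (intro mult_left_mono main) simp
    also have "\<dots> = ennreal (1 / (real n * real n) * (real n * real n)) * ?J"
    proof -
      have "of_nat n * (of_nat n * ?J) = ennreal (real n * real n) * ?J"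
        by (simp only: ennreal_of_nat_eq_real_of_nat ennreal_mult of_nat_0_le_iff mult.assoc)
      then show ?thesis
        by (simp only: ennreal_mult[of "1 / (real n * real n)" "real n * real n"] mult.assoc
            zero_le_divide_1_iff zero_le_mult_iff of_nat_0_le_iff simp_thms)
    qed
    also have "\<dots> = ?J" using n by simp
    finally show "ennreal c * emeasure \<nu> A \<le> ?J" .
  qed
qed

section \<open>A minorized set of positive measure\<close>

lemma suminf_shift_le:
  fixes f :: "nat \<Rightarrow> ennreal"
  shows "(\<Sum>s. f (t + s)) \<le> suminf f"
  using suminf_offset[of f t] by (simp add: add.commute)

context markov_kernel
begin

definition resolvent :: "'a \<Rightarrow> 'a set \<Rightarrow> ennreal" where
  "resolvent x A = (\<Sum>t. ennreal ((1/2) ^ t) * emeasure (kernel_pow P t x) A)"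

lemma resolvent_measurable [measurable]:
  assumes "A \<in> sets borel"
  shows "(\<lambda>x. resolvent x A) \<in> borel_measurable borel"
proof -
  have [measurable]: "(\<lambda>x. emeasure (kernel_pow P t x) A) \<in> borel_measurable borel" for t
    by (rule measurable_compose[OF kernel_pow_subprob measurable_emeasure_subprob_algebra[OF assms]])
  show ?thesis
    unfolding resolvent_def by measurable
qed

lemma resolvent_kernel_pow_le:
  assumes [measurable]: "A \<in> sets borel"
  shows "(\<integral>\<^sup>+y. resolvent y A \<partial>kernel_pow P t x) \<le> ennreal (2 ^ t) * resolvent x A"
proof -
  have "(\<integral>\<^sup>+y. resolvent y A \<partial>kernel_pow P t x) =
      (\<Sum>s. ennreal ((1/2) ^ s) * emeasure (kernel_pow P (t + s) x) A)"
    unfolding resolvent_def emeasure_kernel_pow_add[OF assms]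
    by (subst nn_integral_suminf) (auto simp: nn_integral_cmult)
  also have "\<dots> = (\<Sum>s. ennreal (2 ^ t) * (ennreal ((1/2) ^ (t + s)) * emeasure (kernel_pow P (t + s) x) A))"
    unfolding mult.assoc[symmetric]
    by (simp add: ennreal_mult[symmetric] power_add power_one_over)
  also have "\<dots> = ennreal (2 ^ t) * (\<Sum>s. ennreal ((1/2) ^ (t + s)) * emeasure (kernel_pow P (t + s) x) A)"
    by simp
  also have "\<dots> \<le> ennreal (2 ^ t) * resolvent x A"
    unfolding resolvent_def by (intro mult_left_mono suminf_shift_le) simp
  finally show ?thesis .
qed

text \<open>
  The weights \<open>2\<^bsup>-t\<^esup>\<close> of the resolvent have finite mean.
\<close>

lemma small_set_of_resolvent:
  assumes C: "C \<in> sets borel" and \<nu>: "prob_space \<nu>" "sets \<nu> = sets borel" and "0 < c"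
    and minor: "\<And>x A. x \<in> C \<Longrightarrow> A \<in> sets borel \<Longrightarrow> ennreal c * emeasure \<nu> A \<le> resolvent x A"
  shows "small_set P C"
proof -
  define m where "m = density (count_space UNIV) (\<lambda>t::nat. ennreal ((1/2) ^ t))"
  have m: "emeasure m {t} = ennreal ((1/2) ^ t)" for t
    by (simp add: m_def emeasure_density nn_integral_count_space_indicator[symmetric] nn_integral_count_space_finite)
  have "summable (\<lambda>t. real t * (1/2) ^ t)"
    using sums_summable[OF geometric_deriv_sums[of "1/2::real"]]
      summable_Suc_iff[of "\<lambda>t. real t * (1/2::real) ^ t"] summable_mult[of "\<lambda>t. real (Suc t) * (1/2::real) ^ t" "1/2"]
    by (simp add: mult.left_commute)
  then have "(\<Sum>t. ennreal (real t * (1/2) ^ t)) < \<infinity>"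
    by (subst suminf_ennreal2) auto
  moreover have "(\<integral>\<^sup>+t. of_nat t \<partial>m) = (\<Sum>t. ennreal (real t * (1/2) ^ t))"
    unfolding m_def
    by (subst nn_integral_density)
      (auto simp: nn_integral_count_space_nat ennreal_mult ennreal_of_nat_eq_real_of_nat mult.commute)
  ultimately have mean: "(\<integral>\<^sup>+t. of_nat t \<partial>m) < \<infinity>" by simp
  have "ennreal c * indicator C x * emeasure \<nu> A \<le> (\<Sum>t. emeasure (kernel_pow P t x) A * emeasure m {t})"
    if "A \<in> sets borel" for x and A :: "'a set"
    using minor[of x A] that unfolding m resolvent_def by (auto simp: mult.commute split: split_indicator)
  then show ?thesis
    unfolding small_set_def using C \<nu> \<open>0 < c\<close> mean
    by (intro conjI exI[of _ c] exI[of _ \<nu>] exI[of _ m]) (auto simp: m_def)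
qed

text \<open>
  Smallness is inherited backwards in time: waiting at most \<open>N\<close> steps costs the resolvent a factor of at
  most \<open>2\<^sup>N\<close>.
\<close>

lemma small_set_of_reaching_minorized:
  assumes C: "C \<in> sets borel" and D [measurable]: "D \<in> sets borel"
    and \<nu>: "prob_space \<nu>" "sets \<nu> = sets borel" and c: "0 < c"
    and minor: "\<And>x A. x \<in> D \<Longrightarrow> A \<in> sets borel \<Longrightarrow> ennreal c * emeasure \<nu> A \<le> resolvent x A"
    and d: "0 < d" and reach: "\<And>x. x \<in> C \<Longrightarrow> \<exists>t\<in>{1..N}. ennreal d \<le> emeasure (kernel_pow P t x) D"
  shows "small_set P C"
proof (rule small_set_of_resolvent[OF C \<nu>])
  show "0 < (1/2) ^ N * (c * d)" using c d by simp
  fix x and A :: "'a set" assume "x \<in> C" and A [measurable]: "A \<in> sets borel"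
  then obtain t where t: "t \<le> N" "ennreal d \<le> emeasure (kernel_pow P t x) D"
    using reach by fastforce
  have "ennreal ((1/2) ^ N * (c * d)) * emeasure \<nu> A = ennreal ((1/2) ^ N) * (ennreal c * emeasure \<nu> A * ennreal d)"
    using c d by (simp add: ennreal_mult mult_ac)
  also have "\<dots> \<le> ennreal ((1/2) ^ t) * (ennreal c * emeasure \<nu> A * emeasure (kernel_pow P t x) D)"
    using t by (intro mult_mono ennreal_leI power_decreasing) auto
  also have "ennreal c * emeasure \<nu> A * emeasure (kernel_pow P t x) D =
      (\<integral>\<^sup>+y. ennreal c * emeasure \<nu> A * indicator D y \<partial>kernel_pow P t x)"
    by (rule nn_integral_cmult_indicator[symmetric]) simp
  also have "\<dots> \<le> (\<integral>\<^sup>+y. resolvent y A \<partial>kernel_pow P t x)"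
    using minor A by (intro nn_integral_mono) (auto split: split_indicator)
  also have "\<dots> \<le> ennreal (2 ^ t) * resolvent x A"
    by (rule resolvent_kernel_pow_le) simp
  also have "ennreal ((1/2) ^ t) * (ennreal (2 ^ t) * resolvent x A) = resolvent x A"
    unfolding mult.assoc[symmetric]
    by (simp add: ennreal_mult[symmetric] power_one_over)
  finally show "ennreal ((1/2) ^ N * (c * d)) * emeasure \<nu> A \<le> resolvent x A"
    by (simp add: mult_left_mono)
qed

text \<open>
  The law of the state after an independent geometric number of steps. The success probability \<open>3/4\<close>
  gives weights proportional to \<open>4\<^bsup>-t\<^esup>\<close>, light enough for two successive geometric waiting times to be
  dominated by the weights \<open>2\<^bsup>-t\<^esup>\<close> of \<open>resolvent\<close>.
\<close>

definition resolvent_kernel :: "'a \<Rightarrow> 'a measure" where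
  "resolvent_kernel x = measure_pmf (geometric_pmf (3/4)) \<bind> (\<lambda>t. kernel_pow P t x)"

lemma resolvent_kernel_step [measurable]:
  "(\<lambda>t. kernel_pow P t x) \<in> measure_pmf p \<rightarrow>\<^sub>M subprob_algebra borel"
  by (auto simp: space_subprob_algebra prob_space_imp_subprob_space prob_space_kernel_pow)

lemma nn_integral_resolvent_kernel:
  assumes [measurable]: "f \<in> borel_measurable borel"
  shows "(\<integral>\<^sup>+y. f y \<partial>resolvent_kernel x) = (\<Sum>t. ennreal ((1/4) ^ t * (3/4)) * (\<integral>\<^sup>+y. f y \<partial>kernel_pow P t x))"
proof -
  have "(\<integral>\<^sup>+y. f y \<partial>resolvent_kernel x) = (\<integral>\<^sup>+t. (\<integral>\<^sup>+y. f y \<partial>kernel_pow P t x) \<partial>measure_pmf (geometric_pmf (3/4)))"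
    unfolding resolvent_kernel_def by (rule nn_integral_bind[OF assms resolvent_kernel_step])
  also have "\<dots> = (\<Sum>t. ennreal (pmf (geometric_pmf (3/4)) t) * (\<integral>\<^sup>+y. f y \<partial>kernel_pow P t x))"
    by (simp add: nn_integral_measure_pmf nn_integral_count_space_nat)
  finally show ?thesis by simp
qed

lemma sets_resolvent_kernel [simp]: "sets (resolvent_kernel x) = sets borel"
  unfolding resolvent_kernel_def by (rule sets_bind) auto

lemma emeasure_resolvent_kernel:
  assumes [measurable]: "A \<in> sets borel"
  shows "emeasure (resolvent_kernel x) A = (\<Sum>t. ennreal ((1/4) ^ t * (3/4)) * emeasure (kernel_pow P t x) A)"
  using nn_integral_resolvent_kernel[of "indicator A" x] by simp

lemma resolvent_kernel_prob: "resolvent_kernel \<in> borel \<rightarrow>\<^sub>M prob_algebra borel"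
proof (rule measurable_prob_algebraI)
  show prob: "prob_space (resolvent_kernel x)" for x
    unfolding resolvent_kernel_def
    by (rule prob_space.prob_space_bind[OF measure_pmf.prob_space_axioms _ resolvent_kernel_step])
      (simp add: prob_space_kernel_pow)
  show "resolvent_kernel \<in> borel \<rightarrow>\<^sub>M subprob_algebra borel"
  proof (rule measurable_subprob_algebra)
    fix A :: "'a set" assume A: "A \<in> sets borel"
    have [measurable]: "(\<lambda>x. emeasure (kernel_pow P t x) A) \<in> borel_measurable borel" for t
      by (rule measurable_compose[OF kernel_pow_subprob measurable_emeasure_subprob_algebra[OF A]])
    show "(\<lambda>x. emeasure (resolvent_kernel x) A) \<in> borel_measurable borel"
      unfolding emeasure_resolvent_kernel[OF A] by measurable
  qed (auto intro: prob_space_imp_subprob_space prob)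
qed

text \<open>
  Write \<open>4\<^bsup>-t\<^esup> 4\<^bsup>-s\<^esup> \<le> 2\<^bsup>-t\<^esup> 2\<^bsup>-(t+s)\<^esup>\<close>: for each \<open>t\<close>, the sum over \<open>s\<close> is at most the tail of the resolvent.
\<close>

lemma resolvent_kernel_square_le:
  assumes A [measurable]: "A \<in> sets borel"
  shows "(\<integral>\<^sup>+y. emeasure (resolvent_kernel y) A \<partial>resolvent_kernel x) \<le> 2 * resolvent x A"
proof -
  have [measurable]: "(\<lambda>x. emeasure (kernel_pow P t x) A) \<in> borel_measurable borel" for t
    by (rule measurable_compose[OF kernel_pow_subprob measurable_emeasure_subprob_algebra[OF A]])
  let ?p = "\<lambda>t. emeasure (kernel_pow P t x) A"
  have "(\<integral>\<^sup>+y. emeasure (resolvent_kernel y) A \<partial>resolvent_kernel x) =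
      (\<Sum>t. ennreal ((1/4) ^ t * (3/4)) * (\<integral>\<^sup>+y. (\<Sum>s. ennreal ((1/4) ^ s * (3/4)) * emeasure (kernel_pow P s y) A) \<partial>kernel_pow P t x))"
    unfolding emeasure_resolvent_kernel[OF A] by (rule nn_integral_resolvent_kernel) measurable
  also have "\<dots> = (\<Sum>t. ennreal ((1/4) ^ t * (3/4)) * (\<Sum>s. ennreal ((1/4) ^ s * (3/4)) * ?p (t + s)))"
    unfolding emeasure_kernel_pow_add[OF A]
    by (subst nn_integral_suminf) (auto simp: nn_integral_cmult)
  also have "\<dots> \<le> (\<Sum>t. ennreal ((1/2) ^ t) * resolvent x A)"
  proof (intro suminf_le)
    fix t
    have "ennreal ((1/4) ^ t * (3/4)) * (\<Sum>s. ennreal ((1/4) ^ s * (3/4)) * ?p (t + s)) =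
        (\<Sum>s. ennreal ((1/4) ^ t * (3/4)) * (ennreal ((1/4) ^ s * (3/4)) * ?p (t + s)))"
      by simp
    also have "\<dots> \<le> (\<Sum>s. ennreal ((1/2) ^ t) * (ennreal ((1/2) ^ (t + s)) * ?p (t + s)))"
    proof (intro suminf_le)
      fix s
      \<comment> \<open>The factor \<open>4\<^bsup>-t\<^esup> = 2\<^bsup>-t\<^esup> 2\<^bsup>-t\<^esup>\<close> is split to leave a summable weight for the sum over \<open>t\<close>.\<close>
      have "(1/4 :: real) ^ t * (3/4) * ((1/4) ^ s * (3/4)) \<le> (1/4) ^ t * 1 * ((1/4) ^ s * 1)"
        by (intro mult_mono) auto
      also have "\<dots> \<le> (1/4) ^ t * 1 * ((1/2) ^ s * 1)"
        by (intro mult_mono power_mono) auto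
      also have "\<dots> = (1/2) ^ t * (1/2) ^ (t + s)"
        by (simp add: power_add power_mult_distrib[symmetric] mult.assoc[symmetric])
      finally have "ennreal ((1/4) ^ t * (3/4)) * ennreal ((1/4) ^ s * (3/4)) \<le> ennreal ((1/2) ^ t) * ennreal ((1/2) ^ (t + s))"
        by (simp add: ennreal_mult[symmetric] ennreal_leI)
      then show "ennreal ((1/4) ^ t * (3/4)) * (ennreal ((1/4) ^ s * (3/4)) * ?p (t + s))
          \<le> ennreal ((1/2) ^ t) * (ennreal ((1/2) ^ (t + s)) * ?p (t + s))"
        unfolding mult.assoc[symmetric] by (rule mult_right_mono) simp
    qed auto
    also have "\<dots> = ennreal ((1/2) ^ t) * (\<Sum>s. ennreal ((1/2) ^ (t + s)) * ?p (t + s))"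
      by simp
    also have "\<dots> \<le> ennreal ((1/2) ^ t) * resolvent x A"
      unfolding resolvent_def by (intro mult_left_mono suminf_shift_le) simp
    finally show "ennreal ((1/4) ^ t * (3/4)) * (\<Sum>s. ennreal ((1/4) ^ s * (3/4)) * ?p (t + s)) \<le> ennreal ((1/2) ^ t) * resolvent x A" .
  qed auto
  also have "\<dots> = (\<Sum>t. ennreal ((1/2) ^ t)) * resolvent x A"
    by simp
  also have "(\<Sum>t. ennreal ((1/2) ^ t)) = 2"
    by (subst suminf_ennreal2) (auto simp: suminf_geometric)
  finally show ?thesis .
qed

lemma irreducibility_measure_reaches:
  assumes "irreducibility_measure P \<phi>" "A \<in> sets borel" "emeasure \<phi> A > 0"
  shows "\<exists>s>0. emeasure (kernel_pow P s x) A > 0"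
proof -
  have "\<forall>\<^sub>F t in sequentially. emeasure (kernel_pow P t x) A > 0"
    using assms by (auto simp: irreducibility_measure_def)
  then have "\<forall>\<^sub>F t in sequentially. emeasure (kernel_pow P t x) A > 0 \<and> 0 < t"
    using eventually_gt_at_top[of "0::nat"] by (rule eventually_conj)
  then show ?thesis
    by (auto simp: eventually_sequentially)
qed

text \<open>
  Condition the \<open>\<sigma>\<close>-finite measure on a set of positive finite measure.
\<close>

lemma probability_below_irreducibility_measure:
  assumes \<psi>: "irreducibility_measure P \<psi>" "emeasure \<psi> UNIV > 0"
  obtains \<mu> where "prob_space \<mu>" "sets \<mu> = sets borel"
    "\<And>A. A \<in> sets borel \<Longrightarrow> emeasure \<mu> A > 0 \<Longrightarrow> emeasure \<psi> A > 0"
proof -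
  have sets_\<psi>: "sets \<psi> = sets borel" and "sigma_finite_measure \<psi>"
    using \<psi>(1) by (auto simp: irreducibility_measure_def)
  then interpret sigma_finite_measure \<psi> by simp
  have space_\<psi>: "space \<psi> = UNIV" using sets_eq_imp_space_eq[OF sets_\<psi>] by simp
  obtain B :: "nat \<Rightarrow> 'a set" where B: "range B \<subseteq> sets \<psi>" "(\<Union>i. B i) = space \<psi>" "\<And>i. emeasure \<psi> (B i) \<noteq> \<infinity>"
    using sigma_finite by blast
  have "\<exists>i. emeasure \<psi> (B i) > 0"
  proof (rule ccontr)
    assume "\<not> ?thesis"
    then have "(\<Union>i. B i) \<in> null_sets \<psi>"
      using B(1) by (intro null_sets_UN') auto
    then show False
      using \<psi>(2) B(2) by (auto simp: space_\<psi>)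
  qed
  then obtain i where i: "emeasure \<psi> (B i) > 0" by blast
  show thesis
  proof (rule that[of "uniform_measure \<psi> (B i)"])
    show "prob_space (uniform_measure \<psi> (B i))"
      using i B(3) by (intro prob_space_uniform_measure) auto
    show "sets (uniform_measure \<psi> (B i)) = sets borel" by (simp add: sets_\<psi>)
    fix A :: "'a set" assume A: "A \<in> sets borel" "emeasure (uniform_measure \<psi> (B i)) A > 0"
    have "B i \<in> sets \<psi>" using B(1) by auto
    then have "emeasure \<psi> (B i \<inter> A) / emeasure \<psi> (B i) > 0"
      using A sets_\<psi> by simp
    then have "emeasure \<psi> (B i \<inter> A) > 0"
      by (auto simp: ennreal_zero_less_divide)
    also have "emeasure \<psi> (B i \<inter> A) \<le> emeasure \<psi> A"
      using A by (intro emeasure_mono) (auto simp: sets_\<psi>)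
    finally show "emeasure \<psi> A > 0" .
  qed
qed

lemma exists_minorized_positive_set:
  assumes \<psi>: "irreducibility_measure P \<psi>" "emeasure \<psi> UNIV > 0"
  obtains D and \<nu> :: "'a measure" and c :: real where "D \<in> sets borel" "emeasure \<psi> D > 0" "prob_space \<nu>" "sets \<nu> = sets borel" "0 < c"
    "\<And>x A. x \<in> D \<Longrightarrow> A \<in> sets borel \<Longrightarrow> ennreal c * emeasure \<nu> A \<le> resolvent x A"
proof -
  obtain \<mu> where \<mu>: "prob_space \<mu>" "sets \<mu> = sets borel"
    and pos: "\<And>A. A \<in> sets borel \<Longrightarrow> emeasure \<mu> A > 0 \<Longrightarrow> emeasure \<psi> A > 0"
    by (rule probability_below_irreducibility_measure[OF \<psi>]) (rule that)
  have ac: "emeasure \<mu> A = 0" if A: "A \<in> sets borel" "emeasure (resolvent_kernel x) A = 0" for x A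
  proof (rule ccontr)
    assume "emeasure \<mu> A \<noteq> 0"
    then have "emeasure \<psi> A > 0" using pos A(1) by (simp add: zero_less_iff_neq_zero)
    then obtain s where s: "emeasure (kernel_pow P s x) A > 0"
      using irreducibility_measure_reaches[OF \<psi>(1) A(1)] by blast
    have "ennreal ((1/4) ^ s * (3/4)) * emeasure (kernel_pow P s x) A \<le> emeasure (resolvent_kernel x) A"
      unfolding emeasure_resolvent_kernel[OF A(1)]
      using sum_le_suminf[of "\<lambda>t. ennreal ((1/4) ^ t * (3/4)) * emeasure (kernel_pow P t x) A" "{s}"] by simp
    then have "ennreal ((1/4) ^ s * (3/4)) = 0"
      using s unfolding A(2) le_zero_eq mult_eq_0_iff by (metis less_irrefl)
    moreover have "0 < (1/4 :: real) ^ s * (3/4)" by simp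
    ultimately show False unfolding ennreal_eq_0_iff by linarith
  qed
  obtain D and \<nu> :: "'a measure" and c :: real where D: "D \<in> sets borel" "emeasure \<mu> D > 0"
    and \<nu>: "prob_space \<nu>" "sets \<nu> = sets borel" and c: "0 < c"
    and minor: "\<And>x A. x \<in> D \<Longrightarrow> A \<in> sets borel \<Longrightarrow>
      ennreal c * emeasure \<nu> A \<le> (\<integral>\<^sup>+y. emeasure (resolvent_kernel y) A \<partial>resolvent_kernel x)"
    by (rule kernel_square_minorized[OF resolvent_kernel_prob \<mu> ac]) (assumption+, rule that)
  show thesis
  proof (rule that[OF D(1) pos[OF D] \<nu>])
    show "0 < c / 2" using c by simp
    fix x and A :: "'a set" assume "x \<in> D" "A \<in> sets borel"
    then have le: "ennreal c * emeasure \<nu> A \<le> 2 * resolvent x A"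
      using minor resolvent_kernel_square_le order_trans by blast
    have "ennreal (c / 2) * emeasure \<nu> A = ennreal (1/2) * (ennreal c * emeasure \<nu> A)"
      using c unfolding mult.assoc[symmetric] by (subst ennreal_mult[symmetric]) auto
    also have "\<dots> \<le> ennreal (1/2) * (2 * resolvent x A)"
      by (rule mult_left_mono[OF le]) simp
    also have "\<dots> = (ennreal (1/2) * ennreal 2) * resolvent x A"
      by (simp only: mult.assoc ennreal_numeral)
    also have "ennreal (1/2) * ennreal 2 = 1"
      by (subst ennreal_mult[symmetric]) auto
    finally show "ennreal (c / 2) * emeasure \<nu> A \<le> resolvent x A" by simp
  qed
qed

end

section \<open>Recurrent sets are positive\<close>

context markov_kernel
begin

text \<open>
  If \<open>\<psi> C = 0\<close>, then \<open>\<mu> P\<^sup>t\<close> does not charge \<open>C\<close> either, because \<open>\<mu> P\<^sup>t\<close> is again an irreducibility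
  measure and \<open>\<psi>\<close> is maximal. So some starting point never visits \<open>C\<close>.
\<close>

lemma recurrent_set_positive:
  assumes \<psi>: "irreducible_aperiodic P \<psi>" and C [measurable]: "C \<in> sets borel"
    and surv: "\<And>x. (\<lambda>n. survival C n x) \<longlonglongrightarrow> 0"
  shows "emeasure \<psi> C > 0"
proof (rule ccontr)
  assume "\<not> emeasure \<psi> C > 0"
  then have null: "emeasure \<psi> C = 0" by (simp add: zero_less_iff_neq_zero)
  have irr: "irreducibility_measure P \<psi>" and "emeasure \<psi> UNIV > 0"
    and maximal: "\<And>\<phi>. irreducibility_measure P \<phi> \<Longrightarrow> absolutely_continuous \<psi> \<phi>"
    using \<psi> by (auto simp: irreducible_aperiodic_def)
  obtain \<mu> where \<mu>: "prob_space \<mu>" and sets_\<mu> [measurable_cong]: "sets \<mu> = sets borel"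
    and pos: "\<And>A. A \<in> sets borel \<Longrightarrow> emeasure \<mu> A > 0 \<Longrightarrow> emeasure \<psi> A > 0"
    by (rule probability_below_irreducibility_measure[OF irr \<open>emeasure \<psi> UNIV > 0\<close>]) (rule that)
  interpret \<mu>: prob_space \<mu> by (rule \<mu>)
  have space_\<mu>: "space \<mu> = UNIV" using sets_eq_imp_space_eq[OF sets_\<mu>] by simp
  have kp: "kernel_pow P t \<in> \<mu> \<rightarrow>\<^sub>M subprob_algebra borel" for t
    unfolding measurable_cong_sets[OF sets_\<mu> refl] by (rule kernel_pow_subprob)
  have em: "(\<lambda>x. emeasure (kernel_pow P t x) A) \<in> borel_measurable borel" if "A \<in> sets borel" for t A
    by (rule measurable_compose[OF kernel_pow_subprob measurable_emeasure_subprob_algebra[OF that]])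
  have "AE x in \<mu>. emeasure (kernel_pow P t x) C = 0" for t
  proof -
    let ?\<phi> = "\<mu> \<bind> kernel_pow P t"
    have emeasure_\<phi>: "emeasure ?\<phi> A = (\<integral>\<^sup>+x. emeasure (kernel_pow P t x) A \<partial>\<mu>)" if "A \<in> sets borel" for A
      by (rule emeasure_bind[OF _ kp that]) (simp add: space_\<mu>)
    have sets_\<phi>: "sets ?\<phi> = sets borel"
      by (rule sets_bind) (auto simp: space_\<mu>)
    have "irreducibility_measure P ?\<phi>"
      unfolding irreducibility_measure_def
    proof (intro conjI ballI impI allI)
      show "sets ?\<phi> = sets borel" by (rule sets_\<phi>)
      have "prob_space ?\<phi>"
        by (rule \<mu>.prob_space_bind[OF _ kp]) (simp add: prob_space_kernel_pow)
      then show "sigma_finite_measure ?\<phi>"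
        by (rule prob_space_imp_sigma_finite)
      fix A x assume A: "A \<in> sets borel" "emeasure ?\<phi> A > 0"
      note [measurable] = em[OF A(1)]
      define E where "E = {y. emeasure (kernel_pow P t y) A \<noteq> 0}"
      have E [measurable]: "E \<in> sets borel"
        unfolding E_def by measurable
      have "emeasure \<mu> E > 0"
      proof (rule ccontr)
        assume "\<not> ?thesis"
        then have "E \<in> null_sets \<mu>" by (auto simp: sets_\<mu>)
        then have "AE x in \<mu>. emeasure (kernel_pow P t x) A = 0"
          by (rule eventually_mono[OF AE_not_in]) (simp add: E_def)
        then have "(\<integral>\<^sup>+x. emeasure (kernel_pow P t x) A \<partial>\<mu>) = (\<integral>\<^sup>+x. 0 \<partial>\<mu>)"
          by (rule nn_integral_cong_AE)
        then show False using A by (simp add: emeasure_\<phi>)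
      qed
      then have "\<forall>\<^sub>F s in sequentially. emeasure (kernel_pow P s x) E > 0"
        using irr pos[OF E] E by (auto simp: irreducibility_measure_def)
      then have "\<forall>\<^sub>F s in sequentially. emeasure (kernel_pow P (s + t) x) A > 0"
      proof eventually_elim
        fix s assume "emeasure (kernel_pow P s x) E > 0"
        show "emeasure (kernel_pow P (s + t) x) A > 0"
        proof (rule ccontr)
          assume "\<not> ?thesis"
          then have "(\<integral>\<^sup>+y. emeasure (kernel_pow P t y) A \<partial>kernel_pow P s x) = 0"
            by (simp add: emeasure_kernel_pow_add[OF A(1)] zero_less_iff_neq_zero)
          then have "AE y in kernel_pow P s x. emeasure (kernel_pow P t y) A = 0"
            by (subst (asm) nn_integral_0_iff_AE) auto
          then have "emeasure (kernel_pow P s x) E = 0"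
            by (subst (asm) AE_iff_measurable[of E]) (auto simp: E_def)
          then show False using \<open>emeasure (kernel_pow P s x) E > 0\<close> by simp
        qed
      qed
      then show "\<forall>\<^sub>F u in sequentially. emeasure (kernel_pow P u x) A > 0"
        by (rule eventually_sequentially_seg[THEN iffD1])
    qed
    then have "absolutely_continuous \<psi> ?\<phi>" by (rule maximal)
    moreover have "C \<in> null_sets \<psi>"
      using null irr by (auto simp: irreducibility_measure_def)
    ultimately have "emeasure ?\<phi> C = 0"
      by (auto simp: absolutely_continuous_def)
    then have "(\<integral>\<^sup>+x. emeasure (kernel_pow P t x) C \<partial>\<mu>) = 0"
      by (simp add: emeasure_\<phi>)
    moreover have "(\<lambda>x. emeasure (kernel_pow P t x) C) \<in> borel_measurable \<mu>"
      unfolding measurable_cong_sets[OF sets_\<mu> refl] by (rule em[OF C])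
    ultimately show ?thesis
      by (simp only: nn_integral_0_iff_AE)
  qed
  then have "AE x in \<mu>. \<forall>t. emeasure (kernel_pow P t x) C = 0"
    by (simp add: AE_all_countable)
  then obtain x where x: "\<And>t. emeasure (kernel_pow P t x) C = 0"
    using eventually_happens'[OF \<mu>.ae_filter_bot] by blast
  have "1 \<le> survival C n x" for n
    using one_le_survival_add_hits[OF C, of n x] by (simp add: x del: kernel_pow.simps)
  then have "1 \<le> (0 :: ennreal)"
    by (intro LIMSEQ_le_const[OF surv[of x]]) auto
  then show False by simp
qed

end

section \<open>Equivalence of regularity and drift\<close>

context markov_kernel
begin

text \<open>
  Two exponents are at hand for the return to \<open>C\<close>, one giving finiteness everywhere and one giving
  boundedness on \<open>C\<close>; their minimum gives both.
\<close>

lemma mult_regular_imp_DV3: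
  assumes \<psi>: "irreducible_aperiodic P \<psi>" and H: "H \<in> borel_measurable borel" and H1: "\<And>x. H x \<ge> 1"
    and reg: "mult_regular P \<psi> H"
  shows "\<exists>V. DV3 P V H"
proof -
  obtain C \<eta> where C: "C \<in> sets borel"
    and regC: "\<And>A. A \<in> positive_sets \<psi> \<Longrightarrow> \<exists>\<eta>>0. (SUP x\<in>C. exp_moment P H A \<eta> x) < \<infinity>"
    and \<eta>: "\<eta> > 0" and fin: "\<And>x. exp_moment P H C \<eta> x < \<infinity>"
    using reg by (auto simp: mult_regular_def mult_regular_set_def)
  have irr: "irreducibility_measure P \<psi>" and nz: "emeasure \<psi> UNIV > 0"
    using \<psi> by (auto simp: irreducible_aperiodic_def)
  have "emeasure \<psi> C > 0"
    by (rule recurrent_set_positive[OF \<psi> C survival_tendsto_0_of_exp_moment[OF C H1 \<eta> fin]])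
  then have "C \<in> positive_sets \<psi>" using C by (simp add: positive_sets_def)
  then obtain \<eta>' where \<eta>': "\<eta>' > 0" and bddC: "(SUP x\<in>C. exp_moment P H C \<eta>' x) < \<infinity>"
    using regC by blast
  obtain D and \<nu> :: "'a measure" and c :: real where D: "D \<in> sets borel" "emeasure \<psi> D > 0"
    and \<nu>: "prob_space \<nu>" "sets \<nu> = sets borel" and c: "0 < c"
    and minor: "\<And>x A. x \<in> D \<Longrightarrow> A \<in> sets borel \<Longrightarrow> ennreal c * emeasure \<nu> A \<le> resolvent x A"
    by (rule exists_minorized_positive_set[OF irr nz]) (rule that)
  obtain \<eta>'' where \<eta>'': "\<eta>'' > 0" and bddD: "(SUP x\<in>C. exp_moment P H D \<eta>'' x) < \<infinity>"
    using regC[of D] D by (auto simp: positive_sets_def)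
  obtain N d where d: "0 < d"
    and reach: "\<And>x. x \<in> C \<Longrightarrow> \<exists>t\<in>{1..N}. ennreal d \<le> emeasure (kernel_pow P t x) D"
    by (rule exp_moment_bounded_reaches[OF D(1) H1 \<eta>'' bddD]) (rule that)
  have small: "small_set P C"
    by (rule small_set_of_reaching_minorized[OF C D(1) \<nu> c minor d reach])
  define \<theta> where "\<theta> = min \<eta> \<eta>'"
  have \<theta>: "\<theta> > 0" "\<theta> \<le> \<eta>" "\<theta> \<le> \<eta>'" using \<eta> \<eta>' by (auto simp: \<theta>_def)
  obtain K where K: "(SUP x\<in>C. exp_moment P H C \<eta>' x) = ennreal K"
    using bddC by (cases "SUP x\<in>C. exp_moment P H C \<eta>' x" rule: ennreal_cases) auto
  show ?thesis
  proof (rule exp_moment_imp_DV3[OF small H H1 \<theta>(1)])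
    show "exp_moment P H C \<theta> x < \<infinity>" for x
      using exp_moment_mono[OF \<theta>(2), of H P C x] H1 fin[of x] by (auto intro: le_less_trans)
    show "exp_moment P H C \<theta> x \<le> ennreal K" if "x \<in> C" for x
      using exp_moment_mono[OF \<theta>(3), of H P C x] H1 SUP_upper[OF that, of "exp_moment P H C \<eta>'"]
      unfolding K by (auto intro: order_trans)
  qed
qed

lemma DV3_imp_mult_regular:
  assumes \<psi>: "irreducibility_measure P \<psi>" "emeasure \<psi> UNIV > 0"
    and H: "H \<in> borel_measurable borel" and H1: "\<And>x. H x \<ge> 1"
    and DV3: "DV3 P V W" and HW: "H \<in> L_infty W"
  shows "mult_regular P \<psi> H"
proof -
  have V [measurable]: "V \<in> borel_measurable borel" and Vpos: "\<And>x. V x > 0"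
    using DV3 by (auto simp: DV3_def)
  have sets_\<psi>: "sets \<psi> = sets borel"
    using \<psi>(1) by (simp add: irreducibility_measure_def)
  have bound: "\<exists>\<epsilon>>0. \<exists>\<eta>>0. \<exists>B. \<forall>x. exp_moment P H A \<epsilon> x \<le> ennreal (exp (\<eta> * V x + B))" if A: "A \<in> positive_sets \<psi>" for A
  proof -
    have A': "A \<in> sets borel" "emeasure \<psi> A > 0" using A by (auto simp: positive_sets_def)
    obtain \<epsilon> \<eta> B where e: "\<epsilon> > 0" "\<eta> \<le> 1" "\<eta> > 0"
      and le: "\<And>x. (\<integral>\<^sup>+\<omega>. exp_ext (ereal \<epsilon> * path_sum H (return_time A \<omega>) \<omega>
        + ereal (\<eta> * V (\<omega> (the_enat (return_time A \<omega>))))) \<partial>path_law P x) \<le> ennreal (exp (\<eta> * V x + B))"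
      by (rule DV3_exponential_bound[OF DV3 HW H H1 A'(1) irreducibility_measure_reaches[OF \<psi>(1) A']]) (rule that)
    have "exp_moment P H A \<epsilon> x \<le> ennreal (exp (\<eta> * V x + B))" for x
      unfolding exp_moment_def
    proof (rule order_trans[OF nn_integral_mono le])
      fix \<omega>
      have "0 \<le> ereal (\<eta> * V (\<omega> (the_enat (return_time A \<omega>))))"
        using e Vpos by (simp add: less_imp_le)
      then show "exp_ext (ereal \<epsilon> * path_sum H (return_time A \<omega>) \<omega>) \<le>
          exp_ext (ereal \<epsilon> * path_sum H (return_time A \<omega>) \<omega> + ereal (\<eta> * V (\<omega> (the_enat (return_time A \<omega>)))))"
        by (intro exp_ext_mono) (metis add.right_neutral add_left_mono)
    qed
    then show ?thesis using e by blast
  qed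
  define L where "L n = {x. V x \<le> real n}" for n :: nat
  have L [measurable]: "L n \<in> sets borel" for n
    unfolding L_def by measurable
  have "\<exists>n. emeasure \<psi> (L n) > 0"
  proof (rule ccontr)
    assume "\<not> ?thesis"
    then have "(\<Union>n. L n) \<in> null_sets \<psi>"
      by (intro null_sets_UN') (auto simp: sets_\<psi>)
    moreover have "(\<Union>n. L n) = UNIV"
      by (auto simp: L_def intro: real_arch_simple)
    ultimately show False using \<psi>(2) by auto
  qed
  then obtain n where n: "L n \<in> positive_sets \<psi>"
    using L by (auto simp: positive_sets_def)
  have "mult_regular_set P \<psi> H (L n)"
    unfolding mult_regular_set_def
  proof (intro conjI ballI L)
    fix A assume "A \<in> positive_sets \<psi>"
    then obtain \<epsilon> \<eta> B where e: "\<epsilon> > 0" "\<eta> > 0" and le: "\<And>x. exp_moment P H A \<epsilon> x \<le> ennreal (exp (\<eta> * V x + B))"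
      using bound by blast
    have "(SUP x\<in>L n. exp_moment P H A \<epsilon> x) \<le> ennreal (exp (\<eta> * real n + B))"
    proof (rule SUP_least)
      fix x assume "x \<in> L n"
      then have "exp (\<eta> * V x + B) \<le> exp (\<eta> * real n + B)" using e by (simp add: L_def)
      then show "exp_moment P H A \<epsilon> x \<le> ennreal (exp (\<eta> * real n + B))"
        using le[of x] by (meson ennreal_leI order_trans)
    qed
    then show "\<exists>\<eta>>0. (SUP x\<in>L n. exp_moment P H A \<eta> x) < \<infinity>"
      using e by (intro exI[of _ \<epsilon>]) (auto intro: le_less_trans)
  qed
  moreover obtain \<epsilon> \<eta> B where "\<epsilon> > 0" and le: "\<And>x. exp_moment P H (L n) \<epsilon> x \<le> ennreal (exp (\<eta> * V x + B))"
    using bound[OF n] by blast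
  then have "\<exists>\<epsilon>>0. \<forall>x. exp_moment P H (L n) \<epsilon> x < \<infinity>"
    by (intro exI[of _ \<epsilon>]) (auto intro: le_less_trans[OF le])
  ultimately show ?thesis
    unfolding mult_regular_def by blast
qed

end

theorem theorem2p5:
  fixes P :: "'a::polish_space \<Rightarrow> 'a measure"
    and \<psi> :: "'a measure"
    and H :: "'a \<Rightarrow> real"
  assumes "P \<in> borel \<rightarrow>\<^sub>M prob_algebra borel"
    and "irreducible_aperiodic P \<psi>"
    and "H \<in> borel_measurable borel"
    and "\<forall>x. H x \<ge> 1"
  shows "(mult_regular P \<psi> H \<longleftrightarrow> (\<exists>V W. DV3 P V W \<and> H \<in> L_infty W)) \<and>
    (\<forall>V W. DV3 P V W \<and> H \<in> L_infty W \<longrightarrow>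
       (\<forall>A\<in>positive_sets \<psi>. \<exists>\<epsilon> \<eta> B. \<epsilon> > 0 \<and> 1 \<ge> \<eta> \<and> \<eta> > 0 \<and>
          (\<forall>x. (\<integral>\<^sup>+\<omega>. exp_ext (ereal \<epsilon> * path_sum H (return_time A \<omega>) \<omega>
                            + ereal (\<eta> * V (\<omega> (the_enat (return_time A \<omega>))))) \<partial>path_law P x)
               \<le> ennreal (exp (\<eta> * V x + B)))))"
proof -
  interpret markov_kernel P
    using assms(1) by (rule markov_kernel.intro)
  have irr: "irreducibility_measure P \<psi>" and nz: "emeasure \<psi> UNIV > 0"
    using assms(2) by (auto simp: irreducible_aperiodic_def)
  have H1: "H x \<ge> 1" for x using assms(4) by blast
  show ?thesis
  proof (intro conjI iffI allI impI ballI)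
    assume "mult_regular P \<psi> H"
    then obtain V where "DV3 P V H"
      using mult_regular_imp_DV3[OF assms(2,3) H1] by blast
    then show "\<exists>V W. DV3 P V W \<and> H \<in> L_infty W"
      using L_infty_self[OF assms(3) H1] by blast
  next
    assume "\<exists>V W. DV3 P V W \<and> H \<in> L_infty W"
    then show "mult_regular P \<psi> H"
      using DV3_imp_mult_regular[OF irr nz assms(3) H1] by blast
  next
    fix V W A assume VW: "DV3 P V W \<and> H \<in> L_infty W" and "A \<in> positive_sets \<psi>"
    then have A: "A \<in> sets borel" "emeasure \<psi> A > 0" by (auto simp: positive_sets_def)
    show "\<exists>\<epsilon> \<eta> B. \<epsilon> > 0 \<and> 1 \<ge> \<eta> \<and> \<eta> > 0 \<and>
          (\<forall>x. (\<integral>\<^sup>+\<omega>. exp_ext (ereal \<epsilon> * path_sum H (return_time A \<omega>) \<omega>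
                            + ereal (\<eta> * V (\<omega> (the_enat (return_time A \<omega>))))) \<partial>path_law P x)
               \<le> ennreal (exp (\<eta> * V x + B)))"
    proof (rule DV3_exponential_bound[OF conjunct1[OF VW] conjunct2[OF VW] assms(3) H1 A(1)
          irreducibility_measure_reaches[OF irr A]], goal_cases)
      case (1 \<epsilon> \<eta> B)
      then show ?case by blast
    qed
  qed
qed

end
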